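(* Let $p\in\mathbb P_{\mathbb K}V$ be nonisotropic and let $W\subset T_p\mathbb P_{\mathbb K}V$ be a 2-dimensional $\mathbb R$-vector subspace such that the metric, being restricted to $W$, is nondegenerate. Let $t_1,t_2\in W$ be $\mathbb R$-linearly independent of the form $t_j=v_j\langle p,-\rangle$ with $v_j\in p^\perp$ and $\langle v_j,v_j\rangle=\sigma_j\in\{-1,0,+1\}$, $j=1,2$, and put $k:=\langle v_1,v_2\rangle$. Then the sectional curvature $$SW:=\frac{\big(R(t_1,t_2)t_1,t_2\big)}{(t_1,t_1)(t_2,t_2)-(t_1,t_2)^2}$$ of $W$ is given by $$SW=\pm\Big(1+\frac{3|k-\overline k|^2}{4\big(\sigma_1\sigma_2-(\mathrm{Re}\,k)^2\big)}\Big),$$ where the sign $\pm$ is the same as the one in the definition of the metric.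
   Context: $\mathbb K$ is $\mathbb R$, $\mathbb C$ or $\mathbb H$ (quaternions). $V$ is a finite-dimensional right $\mathbb K$-vector space with a nondegenerate hermitian form $\langle-,-\rangle$: it takes values in $\mathbb K$, is biadditive, and satisfies $\langle v_1k,v_2\rangle=\overline k\langle v_1,v_2\rangle$, $\langle v_1,v_2k\rangle=\langle v_1,v_2\rangle k$, $\langle v_1,v_2\rangle=\overline{\langle v_2,v_1\rangle}$. A point of $\mathbb P_{\mathbb K}V$, a representative in $V$, and the corresponding one-dimensional subspace are denoted by the same letter (here a representative $p\in V$ is fixed). A point $p$ is isotropic if $\langle p,p\rangle=0$; $SV$ is the set of isotropic points. For $p$ nonisotropic, $V=p\oplus p^\perp$ and $T_p\mathbb P_{\mathbb K}V=\mathrm{Lin}_{\mathbb K}(p,p^\perp)=p^\perp\langle p,-\rangle$, where $\varphi:p\to p^\perp$ corresponds to the derivation $f\mapsto\frac{d}{d\varepsilon}|_{\varepsilon=0}\hat f(p+\varepsilon\varphi p)$, $\hat f$ being the lift of $f$ to $V\setminus\{0\}$, and $v\langle p,-\rangle$ is the map $x\mapsto v\langle p,x\rangle$. The metric is $(t_1,t_2):=\pm\frac{\mathrm{tr}_{\mathbb R}(t_1^*t_2)}{\dim_{\mathbb R}\mathbb K}$ for $t_1,t_2\in T_p\mathbb P_{\mathbb K}V$ (one of the signs being fixed), where $t_1^*$ is the adjoint with respect to $\langle-,-\rangle$; it is a pseudo-riemannian metric on $\mathbb P_{\mathbb K}V\setminus SV$. With $\nabla$ its Levi-Civita connection, the curvature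 tensor is $R(T_1,T_2)S:=\nabla_{T_2}\nabla_{T_1}S-\nabla_{T_1}\nabla_{T_2}S+\nabla_{[T_1,T_2]}S$. *)

theory Defs
  imports "HOL-Analysis.Analysis"
begin

section \<open>The scalars: \<open>\<real>\<close>, \<open>\<complex>\<close> and the quaternions\<close>

codatatype quat = Quat (qRe: real) (qIm1: real) (qIm2: real) (qIm3: real)

lemma quat_eq_iff:
  "x = y \<longleftrightarrow> qRe x = qRe y \<and> qIm1 x = qIm1 y \<and> qIm2 x = qIm2 y \<and> qIm3 x = qIm3 y"
  by (auto intro: quat.expand)

instantiation quat :: ab_group_add
begin

primcorec zero_quat where
  "qRe 0 = 0" | "qIm1 0 = 0" | "qIm2 0 = 0" | "qIm3 0 = 0"

primcorec plus_quat where
  "qRe (x + y) = qRe x + qRe y"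
| "qIm1 (x + y) = qIm1 x + qIm1 y"
| "qIm2 (x + y) = qIm2 x + qIm2 y"
| "qIm3 (x + y) = qIm3 x + qIm3 y"

primcorec uminus_quat where
  "qRe (- x) = - qRe x"
| "qIm1 (- x) = - qIm1 x"
| "qIm2 (- x) = - qIm2 x"
| "qIm3 (- x) = - qIm3 x"

primcorec minus_quat where
  "qRe (x - y) = qRe x - qRe y"
| "qIm1 (x - y) = qIm1 x - qIm1 y"
| "qIm2 (x - y) = qIm2 x - qIm2 y"
| "qIm3 (x - y) = qIm3 x - qIm3 y"

instance by standard (simp_all add: quat_eq_iff)

end

instantiation quat :: real_vector
begin

primcorec scaleR_quat where
  "qRe (scaleR r x) = r * qRe x"
| "qIm1 (scaleR r x) = r * qIm1 x"
| "qIm2 (scaleR r x) = r * qIm2 x"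
| "qIm3 (scaleR r x) = r * qIm3 x"

instance by standard (simp_all add: quat_eq_iff algebra_simps)

end

instantiation quat :: real_algebra_1
begin

primcorec one_quat where
  "qRe 1 = 1" | "qIm1 1 = 0" | "qIm2 1 = 0" | "qIm3 1 = 0"

primcorec times_quat where
  "qRe (x * y) = qRe x * qRe y - qIm1 x * qIm1 y - qIm2 x * qIm2 y - qIm3 x * qIm3 y"
| "qIm1 (x * y) = qRe x * qIm1 y + qIm1 x * qRe y + qIm2 x * qIm3 y - qIm3 x * qIm2 y"
| "qIm2 (x * y) = qRe x * qIm2 y - qIm1 x * qIm3 y + qIm2 x * qRe y + qIm3 x * qIm1 y"
| "qIm3 (x * y) = qRe x * qIm3 y + qIm1 x * qIm2 y - qIm2 x * qIm1 y + qIm3 x * qRe y"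

instance by standard (simp_all add: quat_eq_iff algebra_simps)

end

primcorec qcnj :: "quat \<Rightarrow> quat" where
  "qRe (qcnj x) = qRe x"
| "qIm1 (qcnj x) = - qIm1 x"
| "qIm2 (qcnj x) = - qIm2 x"
| "qIm3 (qcnj x) = - qIm3 x"

instantiation quat :: real_inner
begin

definition inner_quat_def:
  "inner x y = qRe x * qRe y + qIm1 x * qIm1 y + qIm2 x * qIm2 y + qIm3 x * qIm3 y"

definition norm_quat_def: "norm (x::quat) = sqrt (inner x x)"

definition sgn_quat_def: "sgn (x::quat) = x /\<^sub>R norm x"

definition dist_quat_def: "dist (x::quat) y = norm (x - y)"

definition uniformity_quat_def [code del]:
  "(uniformity :: (quat \<times> quat) filter) = (INF e\<in>{0 <..}. principal {(x, y). dist x y < e})"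

definition open_quat_def [code del]:
  "open (U :: quat set) \<longleftrightarrow> (\<forall>x\<in>U. eventually (\<lambda>(x', y). x' = x \<longrightarrow> y \<in> U) uniformity)"

instance
proof
  fix x y z :: quat and r :: real
  show "inner x y = inner y x"
    by (simp add: inner_quat_def mult.commute)
  show "inner (x + y) z = inner x z + inner y z"
    by (simp add: inner_quat_def algebra_simps)
  show "inner (scaleR r x) y = r * inner x y"
    by (simp add: inner_quat_def algebra_simps)
  show "0 \<le> inner x x"
    by (simp add: inner_quat_def)
  show "inner x x = 0 \<longleftrightarrow> x = 0"
    by (simp add: inner_quat_def quat_eq_iff add_nonneg_eq_0_iff)
qed (rule norm_quat_def sgn_quat_def dist_quat_def open_quat_def uniformity_quat_def)+

end

lemma norm_quat_squared: "(norm (x::quat))\<^sup>2 = inner x x"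
  by (simp add: power2_norm_eq_inner)

instantiation quat :: real_normed_div_algebra
begin

definition inverse_quat_def: "inverse (x::quat) = qcnj x /\<^sub>R (norm x)\<^sup>2"

definition divide_quat_def: "(x::quat) div y = x * inverse y"

instance
proof
  fix x y :: quat
  have cnj: "qcnj x * x = (norm x)\<^sup>2 *\<^sub>R 1" "x * qcnj x = (norm x)\<^sup>2 *\<^sub>R 1"
    unfolding norm_quat_squared by (simp_all add: inner_quat_def quat_eq_iff algebra_simps)
  show "x \<noteq> 0 \<Longrightarrow> inverse x * x = 1" "x \<noteq> 0 \<Longrightarrow> x * inverse x = 1"
    by (simp_all add: inverse_quat_def cnj)
  show "x div y = x * inverse y"
    by (rule divide_quat_def)
  show "inverse (0::quat) = 0"
    by (simp add: inverse_quat_def quat_eq_iff)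
  have "(norm (x * y))\<^sup>2 = (norm x * norm y)\<^sup>2"
    unfolding power_mult_distrib norm_quat_squared inner_quat_def times_quat.sel by algebra
  then show "norm (x * y) = norm x * norm y"
    by (simp add: power2_eq_iff_nonneg)
qed

end

instantiation quat :: euclidean_space
begin

definition Basis_quat_def:
  "Basis = {Quat 1 0 0 0, Quat 0 1 0 0, Quat 0 0 1 0, Quat 0 0 0 1}"

instance
proof
  show "(Basis :: quat set) \<noteq> {}" "finite (Basis :: quat set)"
    by (simp_all add: Basis_quat_def)
  show "inner u v = (if u = v then 1 else 0)" if "u \<in> Basis" "v \<in> Basis" for u v :: quat
    using that unfolding Basis_quat_def insert_iff empty_iff
    by (elim disjE) (simp_all add: inner_quat_def)
  show "(\<forall>u\<in>Basis. inner x u = 0) \<longleftrightarrow> x = 0" for x :: quat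
    unfolding Basis_quat_def ball_simps inner_quat_def by (simp, simp add: quat_eq_iff)
qed

end

lemma DIM_quat [simp]: "DIM(quat) = 4"
  by (simp add: Basis_quat_def)

text \<open>
  By the theorem of Frobenius every type of the following class is isomorphic, with its
  conjugation and its norm, to one of the three instances given below, so that quantifying over
  the class is quantifying over \<open>\<real>\<close>, \<open>\<complex>\<close> and the quaternions.
\<close>

class rch_algebra = real_normed_div_algebra + euclidean_space +
  fixes conj :: "'a \<Rightarrow> 'a"
  assumes conj_add: "conj (x + y) = conj x + conj y"
    and conj_scaleR: "conj (r *\<^sub>R x) = r *\<^sub>R conj x"
    and conj_mult: "conj (x * y) = conj y * conj x"
    and conj_conj: "conj (conj x) = x"
    and conj_plus_self: "x + conj x = (2 * inner 1 x) *\<^sub>R 1"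
    and conj_mult_self: "conj x * x = (norm x)\<^sup>2 *\<^sub>R 1"

instantiation real :: rch_algebra
begin

definition conj_real_def: "conj (x::real) = x"

instance
proof
  fix x :: real
  show "conj x * x = (norm x)\<^sup>2 *\<^sub>R 1"
    by (simp add: conj_real_def power2_eq_square)
qed (simp_all add: conj_real_def)

end

instantiation complex :: rch_algebra
begin

definition conj_complex_def: "conj = cnj"

instance
proof
  fix x :: complex
  show "conj x * x = (norm x)\<^sup>2 *\<^sub>R 1"
    unfolding conj_complex_def cmod_power2 by (simp add: complex_eq_iff power2_eq_square)
qed (simp_all add: conj_complex_def complex_eq_iff inner_complex_def)

end

instantiation quat :: rch_algebra
begin

definition conj_quat_def: "conj = qcnj"

instance
proof
  fix x y :: quat
  show "conj (x * y) = conj y * conj x"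
    by (simp add: conj_quat_def quat_eq_iff algebra_simps)
  show "conj x * x = (norm x)\<^sup>2 *\<^sub>R 1"
    unfolding conj_quat_def norm_quat_squared by (simp add: inner_quat_def quat_eq_iff)
qed (simp_all add: conj_quat_def quat_eq_iff inner_quat_def)

end

definition re :: "'k::rch_algebra \<Rightarrow> real" where
  "re k = inner 1 k"


section \<open>Smooth maps\<close>

text \<open>On an open set, \<open>Ck_on n\<close> is membership in $C^n$, by recursion on the derivatives in all
  (constant) directions.\<close>

fun Ck_on :: "nat \<Rightarrow> 'a::euclidean_space set \<Rightarrow> ('a \<Rightarrow> 'b::real_normed_vector) \<Rightarrow> bool" where
  "Ck_on 0 U f \<longleftrightarrow> continuous_on U f"
| "Ck_on (Suc n) U f \<longleftrightarrow>
     (\<forall>x\<in>U. f differentiable (at x)) \<and>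
     (\<forall>h. Ck_on n U (\<lambda>x. frechet_derivative f (at x) h))"

definition smooth_on :: "'a::euclidean_space set \<Rightarrow> ('a \<Rightarrow> 'b::real_normed_vector) \<Rightarrow> bool" where
  "smooth_on U f \<longleftrightarrow> (\<forall>n. Ck_on n U f)"


section \<open>Hermitian spaces and their projectivizations\<close>

text \<open>The real trace; its value does not depend on the inner product of the type
  \<^typ>\<open>'v::euclidean_space\<close>.\<close>

definition real_trace :: "('v::euclidean_space \<Rightarrow>\<^sub>L 'v) \<Rightarrow> real" where
  "real_trace A = (\<Sum>b\<in>Basis. inner (blinfun_apply A b) b)"

text \<open>
  A finite-dimensional right vector space over \<^typ>\<open>'k\<close> is given on a type of class
  \<^class>\<open>euclidean_space\<close>, which supplies the underlying real vector space and its
  topology. The inner product of the type is unrelated to the hermitian form \<open>herm\<close>.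
\<close>

locale hermitian_space =
  fixes act :: "'v::euclidean_space \<Rightarrow> 'k::rch_algebra \<Rightarrow> 'v"  (infixl \<open>\<cdot>\<close> 75)
    and herm :: "'v \<Rightarrow> 'v \<Rightarrow> 'k"  (\<open>\<langle>_, _\<rangle>\<close>)
  assumes act_add_left: "(v + w) \<cdot> k = v \<cdot> k + w \<cdot> k"
    and act_add_right: "v \<cdot> (k + l) = v \<cdot> k + v \<cdot> l"
    and act_mult: "v \<cdot> (k * l) = v \<cdot> k \<cdot> l"
    and act_one: "v \<cdot> 1 = v"
    and act_of_real: "v \<cdot> of_real r = r *\<^sub>R v"
    and herm_add_left: "\<langle>v + w, u\<rangle> = \<langle>v, u\<rangle> + \<langle>w, u\<rangle>"
    and herm_add_right: "\<langle>u, v + w\<rangle> = \<langle>u, v\<rangle> + \<langle>u, w\<rangle>"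
    and herm_act_left: "\<langle>v \<cdot> k, w\<rangle> = conj k * \<langle>v, w\<rangle>"
    and herm_act_right: "\<langle>v, w \<cdot> k\<rangle> = \<langle>v, w\<rangle> * k"
    and herm_conj: "\<langle>v, w\<rangle> = conj \<langle>w, v\<rangle>"
    and herm_nondegenerate: "(\<And>w. \<langle>v, w\<rangle> = 0) \<Longrightarrow> v = 0"
begin

text \<open>Points of the projective space are one-dimensional subspaces; a function \<open>F\<close> of points
  lifts to the function \<open>\<lambda>v. F (line v)\<close> of nonzero vectors.\<close>

definition line :: "'v \<Rightarrow> 'v set" where
  "line p = range (\<lambda>k. p \<cdot> k)"

definition proj_space :: "'v set set" where
  "proj_space = line ` (- {0})"

definition isotropic_points :: "'v set set" where
  "isotropic_points = line ` {p. p \<noteq> 0 \<and> \<langle>p, p\<rangle> = 0}"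

definition nonisotropic_points :: "'v set set" where
  "nonisotropic_points = proj_space - isotropic_points"

definition perp :: "'v set \<Rightarrow> 'v set" where
  "perp L = {v. \<forall>x\<in>L. \<langle>x, v\<rangle> = 0}"

text \<open>A linear map from \<open>L\<close> to \<open>perp L\<close> is identified with its extension to the whole space
  by zero on \<open>perp L\<close>, as in the notation \<open>\<lambda>x. v \<cdot> \<langle>p, x\<rangle>\<close>.\<close>

definition tangent_space :: "'v set \<Rightarrow> ('v \<Rightarrow>\<^sub>L 'v) set" where
  "tangent_space L =
     {t. (\<forall>x k. blinfun_apply t (x \<cdot> k) = blinfun_apply t x \<cdot> k) \<and>
         (\<forall>x\<in>L. blinfun_apply t x \<in> perp L) \<and>
         (\<forall>x\<in>perp L. blinfun_apply t x = 0)}"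

definition adj :: "('v \<Rightarrow>\<^sub>L 'v) \<Rightarrow> 'v \<Rightarrow>\<^sub>L 'v" where
  "adj t = (THE s. \<forall>x y. \<langle>blinfun_apply t x, y\<rangle> = \<langle>x, blinfun_apply s y\<rangle>)"

text \<open>The number \<open>\<epsilon>\<close> is the sign fixed in the definition of the metric. For tangent vectors
  \<open>t1\<close>, \<open>t2\<close> at \<open>L\<close> the map \<open>adj t1 o\<^sub>L t2\<close> sends \<open>L\<close> to \<open>L\<close> and vanishes on \<open>perp L\<close>, so its
  trace over the whole space is its trace over \<open>L\<close>.\<close>

definition metric :: "real \<Rightarrow> ('v \<Rightarrow>\<^sub>L 'v) \<Rightarrow> ('v \<Rightarrow>\<^sub>L 'v) \<Rightarrow> real" where
  "metric \<epsilon> t1 t2 = \<epsilon> * (real_trace (adj t1 o\<^sub>L t2) / real DIM('k))"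


subsection \<open>Functions, vector fields and the Levi-Civita connection off the isotropic points\<close>

definition smooth_fun :: "('v set \<Rightarrow> real) \<Rightarrow> bool" where
  "smooth_fun f \<longleftrightarrow> smooth_on {v. line v \<in> nonisotropic_points} (\<lambda>v. f (line v))"

definition derivation :: "'v set \<Rightarrow> ('v \<Rightarrow>\<^sub>L 'v) \<Rightarrow> ('v set \<Rightarrow> real) \<Rightarrow> real" where
  "derivation L t f =
     (THE d. \<forall>p \<in> L - {0}.
        ((\<lambda>e::real. f (line (p + e *\<^sub>R blinfun_apply t p))) has_real_derivative d) (at 0))"

text \<open>The tangent spaces form a smooth subbundle of the trivial bundle with fibre
  \<^typ>\<open>'v \<Rightarrow>\<^sub>L 'v\<close>, so smoothness of a vector field is smoothness as a map into this
  fibre. The value \<open>0\<close> outside the manifold makes equality of vector fields plain equality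
  of functions.\<close>

definition vector_field :: "('v set \<Rightarrow> 'v \<Rightarrow>\<^sub>L 'v) \<Rightarrow> bool" where
  "vector_field T \<longleftrightarrow>
     (\<forall>L \<in> nonisotropic_points. T L \<in> tangent_space L) \<and>
     (\<forall>L. L \<notin> nonisotropic_points \<longrightarrow> T L = 0) \<and>
     smooth_on {v. line v \<in> nonisotropic_points} (\<lambda>v. T (line v))"

definition lie_derivative :: "('v set \<Rightarrow> 'v \<Rightarrow>\<^sub>L 'v) \<Rightarrow> ('v set \<Rightarrow> real) \<Rightarrow> 'v set \<Rightarrow> real" where
  "lie_derivative T f = (\<lambda>L. derivation L (T L) f)"

definition lie_bracket ::
    "('v set \<Rightarrow> 'v \<Rightarrow>\<^sub>L 'v) \<Rightarrow> ('v set \<Rightarrow> 'v \<Rightarrow>\<^sub>L 'v) \<Rightarrow> 'v set \<Rightarrow> 'v \<Rightarrow>\<^sub>L 'v" where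
  "lie_bracket T S =
     (THE Z. vector_field Z \<and>
        (\<forall>f. smooth_fun f \<longrightarrow> (\<forall>L \<in> nonisotropic_points.
           lie_derivative Z f L =
             lie_derivative T (lie_derivative S f) L - lie_derivative S (lie_derivative T f) L)))"

definition affine_connection ::
    "(('v set \<Rightarrow> 'v \<Rightarrow>\<^sub>L 'v) \<Rightarrow> ('v set \<Rightarrow> 'v \<Rightarrow>\<^sub>L 'v) \<Rightarrow> 'v set \<Rightarrow> 'v \<Rightarrow>\<^sub>L 'v) \<Rightarrow> bool" where
  "affine_connection nabla \<longleftrightarrow>
     (\<forall>T S. vector_field T \<and> vector_field S \<longrightarrow> vector_field (nabla T S)) \<and>
     (\<forall>T T' S. vector_field T \<and> vector_field T' \<and> vector_field S \<longrightarrow>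
        nabla (\<lambda>L. T L + T' L) S = (\<lambda>L. nabla T S L + nabla T' S L)) \<and>
     (\<forall>f T S. smooth_fun f \<and> vector_field T \<and> vector_field S \<longrightarrow>
        nabla (\<lambda>L. f L *\<^sub>R T L) S = (\<lambda>L. f L *\<^sub>R nabla T S L)) \<and>
     (\<forall>T S S'. vector_field T \<and> vector_field S \<and> vector_field S' \<longrightarrow>
        nabla T (\<lambda>L. S L + S' L) = (\<lambda>L. nabla T S L + nabla T S' L)) \<and>
     (\<forall>f T S. smooth_fun f \<and> vector_field T \<and> vector_field S \<longrightarrow>
        nabla T (\<lambda>L. f L *\<^sub>R S L) =
          (\<lambda>L. lie_derivative T f L *\<^sub>R S L + f L *\<^sub>R nabla T S L))"

definition levi_civita ::
    "real \<Rightarrow> (('v set \<Rightarrow> 'v \<Rightarrow>\<^sub>L 'v) \<Rightarrow> ('v set \<Rightarrow> 'v \<Rightarrow>\<^sub>L 'v) \<Rightarrow> 'v set \<Rightarrow> 'v \<Rightarrow>\<^sub>L 'v) \<Rightarrow> bool" where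
  "levi_civita \<epsilon> nabla \<longleftrightarrow>
     affine_connection nabla \<and>
     (\<forall>T S. vector_field T \<and> vector_field S \<longrightarrow>
        lie_bracket T S = (\<lambda>L. nabla T S L - nabla S T L)) \<and>
     (\<forall>T S S'. vector_field T \<and> vector_field S \<and> vector_field S' \<longrightarrow>
        (\<forall>L \<in> nonisotropic_points.
           lie_derivative T (\<lambda>L. metric \<epsilon> (S L) (S' L)) L =
             metric \<epsilon> (nabla T S L) (S' L) + metric \<epsilon> (S L) (nabla T S' L)))"


subsection \<open>Curvature\<close>

definition curvature_field ::
    "(('v set \<Rightarrow> 'v \<Rightarrow>\<^sub>L 'v) \<Rightarrow> ('v set \<Rightarrow> 'v \<Rightarrow>\<^sub>L 'v) \<Rightarrow> 'v set \<Rightarrow> 'v \<Rightarrow>\<^sub>L 'v) \<Rightarrow>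
     ('v set \<Rightarrow> 'v \<Rightarrow>\<^sub>L 'v) \<Rightarrow> ('v set \<Rightarrow> 'v \<Rightarrow>\<^sub>L 'v) \<Rightarrow> ('v set \<Rightarrow> 'v \<Rightarrow>\<^sub>L 'v) \<Rightarrow> 'v set \<Rightarrow> 'v \<Rightarrow>\<^sub>L 'v"
  where
  "curvature_field nabla T1 T2 S =
     (\<lambda>L. nabla T2 (nabla T1 S) L - nabla T1 (nabla T2 S) L + nabla (lie_bracket T1 T2) S L)"

text \<open>The curvature tensor at a point: the common value at \<open>L\<close> of \<^const>\<open>curvature_field\<close> on all
  vector fields with the prescribed values at \<open>L\<close>.\<close>

definition curvature ::
    "(('v set \<Rightarrow> 'v \<Rightarrow>\<^sub>L 'v) \<Rightarrow> ('v set \<Rightarrow> 'v \<Rightarrow>\<^sub>L 'v) \<Rightarrow> 'v set \<Rightarrow> 'v \<Rightarrow>\<^sub>L 'v) \<Rightarrow>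
     'v set \<Rightarrow> ('v \<Rightarrow>\<^sub>L 'v) \<Rightarrow> ('v \<Rightarrow>\<^sub>L 'v) \<Rightarrow> ('v \<Rightarrow>\<^sub>L 'v) \<Rightarrow> 'v \<Rightarrow>\<^sub>L 'v" where
  "curvature nabla L t1 t2 s =
     (THE r. \<forall>T1 T2 S. vector_field T1 \<and> vector_field T2 \<and> vector_field S \<and>
        T1 L = t1 \<and> T2 L = t2 \<and> S L = s \<longrightarrow> curvature_field nabla T1 T2 S L = r)"

definition sectional_curvature ::
    "real \<Rightarrow> (('v set \<Rightarrow> 'v \<Rightarrow>\<^sub>L 'v) \<Rightarrow> ('v set \<Rightarrow> 'v \<Rightarrow>\<^sub>L 'v) \<Rightarrow> 'v set \<Rightarrow> 'v \<Rightarrow>\<^sub>L 'v) \<Rightarrow>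
     'v set \<Rightarrow> ('v \<Rightarrow>\<^sub>L 'v) \<Rightarrow> ('v \<Rightarrow>\<^sub>L 'v) \<Rightarrow> real" where
  "sectional_curvature \<epsilon> nabla L t1 t2 =
     metric \<epsilon> (curvature nabla L t1 t2 t1) t2 /
       (metric \<epsilon> t1 t1 * metric \<epsilon> t2 t2 - (metric \<epsilon> t1 t2)\<^sup>2)"

end

end

theory Submission
  imports Defs
begin

text \<open>
  A tangent vector at the point of a nonisotropic \<open>v\<close> is determined by the vector, orthogonal to
  \<open>v\<close>, to which it sends \<open>v\<close>. A vector field \<open>T\<close> is thus the same as its lift
  \<open>v \<mapsto> T (line v) v\<close>, a smooth map that is orthogonal to \<open>v\<close> and equivariant under the
  scalars, and the metric becomes \<open>\<epsilon>\<close> times the real part of the hermitian product of two lifts,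
  divided by \<open>\<langle>v, v\<rangle>\<close> (\<open>metric_eq\<close>). All computations take place on these lifts, in an
  open subset of a real vector space, with the flat derivative.

  Projecting the flat derivative of one lift along another onto the orthogonal complement of \<open>v\<close>
  gives the connection \<open>cov\<close>. Its antisymmetrization is the Lie bracket (\<open>lie_bracket_eq\<close>,
  which rests on the symmetry of second derivatives and on the fact that lifted functions are constant
  along lines), and it preserves the metric (\<open>lie_derivative_metric\<close>). The usual uniqueness argument
  then identifies the given Levi-Civita connection with \<open>cov\<close> (\<open>levi_civita_lift\<close>). That argument
  applies to fields on the whole manifold, because projecting a linear map produces a global
  field through any tangent vector (\<open>horizontal_extension\<close>).

  In the curvature of \<open>cov\<close> all flat second derivatives cancel. What remains comes from the turning
  of the orthogonal complement and from the vertical part of the flat commutator, and for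
  lifts \<open>a\<close>, \<open>b\<close>, \<open>c\<close> it is
  \<open>b \<cdot> \<langle>a, c\<rangle> - a \<cdot> \<langle>b, c\<rangle> + c \<cdot> (\<langle>a, b\<rangle> - \<langle>b, a\<rangle>)\<close>
  divided by \<open>\<langle>v, v\<rangle>\<close> (\<open>curvature_lift\<close>). With \<open>c = a\<close> the pairing with \<open>b\<close> is
  computed in the scalars: \<open>re (k * k)\<close> is \<open>2 * (re k)\<^sup>2 - (norm k)\<^sup>2\<close> in each of the three
  algebras, and the square of the imaginary part of \<open>k\<close>, a quarter of
  \<open>(norm (k - conj k))\<^sup>2\<close>, appears with the factor 3 (\<open>re_herm_curv\<close>). Nondegeneracy
  of the metric on \<open>W\<close> makes the Gram determinant, and hence the denominator, nonzero.
\<close>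

section \<open>Calculus of smooth maps\<close>

lemma Ck_on_cong:
  assumes "open U" "Ck_on n U f" "\<And>x. x \<in> U \<Longrightarrow> f x = g x"
  shows "Ck_on n U g"
  using assms(2,3)
proof (induction n arbitrary: f g)
  case 0
  then show ?case
    by (simp cong: continuous_on_cong)
next
  case (Suc n)
  have diff: "f differentiable (at x)" if "x \<in> U" for x
    using Suc.prems(1) that by simp
  have eq: "frechet_derivative f (at x) = frechet_derivative g (at x)" if "x \<in> U" for x
    using frechet_derivative_transform_within_open[OF diff[OF that] assms(1) that] Suc.prems(2)
    by blast
  have "g differentiable (at x)" if x: "x \<in> U" for x
  proof -
    obtain D where D: "(f has_derivative D) (at x)"
      using diff[OF x] unfolding differentiable_def by blast
    show ?thesis
      using has_derivative_transform_within_open[OF D assms(1) x Suc.prems(2)]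
      unfolding differentiable_def by blast
  qed
  moreover have "Ck_on n U (\<lambda>x. frechet_derivative g (at x) h)" for h
    by (rule Suc.IH[of "\<lambda>x. frechet_derivative f (at x) h"]) (use Suc.prems(1) eq in auto)
  ultimately show ?case
    by simp
qed

lemma Ck_on_SucI:
  assumes "open U" "\<And>x. x \<in> U \<Longrightarrow> (f has_derivative f' x) (at x)"
    and "\<And>h. Ck_on n U (\<lambda>x. f' x h)"
  shows "Ck_on (Suc n) U f"
proof -
  have "Ck_on n U (\<lambda>x. frechet_derivative f (at x) h)" for h
    by (rule Ck_on_cong[OF assms(1) assms(3)[of h]])
      (use frechet_derivative_at[OF assms(2)] in auto)
  then show ?thesis
    using assms(2) by (auto simp: differentiable_def)
qed

lemma Ck_on_SucD1: "Ck_on (Suc n) U f \<Longrightarrow> x \<in> U \<Longrightarrow>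
    (f has_derivative frechet_derivative f (at x)) (at x)"
  by (simp add: frechet_derivative_works[symmetric])

lemma Ck_on_SucD2: "Ck_on (Suc n) U f \<Longrightarrow> Ck_on n U (\<lambda>x. frechet_derivative f (at x) h)"
  by simp

lemma Ck_on_Suc_imp: "Ck_on (Suc n) U f \<Longrightarrow> Ck_on n U f"
proof (induction n arbitrary: f)
  case 0
  then show ?case
    by (auto intro!: continuous_at_imp_continuous_on differentiable_imp_continuous_within)
next
  case (Suc n)
  have "Ck_on n U (\<lambda>x. frechet_derivative f (at x) h)" for h
    by (rule Suc.IH) (use Suc.prems in simp)
  then show ?case
    using Suc.prems by simp
qed

lemma Ck_on_const: "Ck_on n U (\<lambda>x. c)"
  by (induction n arbitrary: c) simp_all

lemma Ck_on_linear:
  assumes "open U" "bounded_linear f"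
  shows "Ck_on n U f"
proof (cases n)
  case 0
  then show ?thesis
    using assms(2) by (simp add: linear_continuous_on)
next
  case (Suc m)
  show ?thesis
    unfolding Suc
    by (rule Ck_on_SucI[where f' = "\<lambda>_. f", OF assms(1)])
      (simp_all add: assms(2) bounded_linear_imp_has_derivative Ck_on_const)
qed

lemma Ck_on_add:
  assumes "open U" "Ck_on n U f" "Ck_on n U g"
  shows "Ck_on n U (\<lambda>x. f x + g x)"
  using assms(2,3)
proof (induction n arbitrary: f g)
  case 0
  then show ?case
    by (simp add: continuous_on_add)
next
  case (Suc n)
  show ?case
    by (rule Ck_on_SucI[OF assms(1) has_derivative_add[OF Ck_on_SucD1 Ck_on_SucD1]])
      (use Suc in auto)
qed

text \<open>The derivative of a product is a sum of two products of the same shape, so the induction on the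
  order of smoothness closes for a fixed bilinear map and arbitrary factors. All smoothness claims
  below reduce to this lemma, its analogue for the reciprocal, and smoothness of linear maps.\<close>

lemma Ck_on_bilinear:
  assumes "open U" "bounded_bilinear B" "Ck_on n U f" "Ck_on n U g"
  shows "Ck_on n U (\<lambda>x. B (f x) (g x))"
  using assms(3,4)
proof (induction n arbitrary: f g)
  case 0
  then show ?case
    by (simp add: bounded_bilinear.continuous_on[OF assms(2)])
next
  case (Suc n)
  have "Ck_on n U f" "Ck_on n U g"
    using Suc.prems by (auto intro: Ck_on_Suc_imp)
  then have "Ck_on n U (\<lambda>x. B (f x) (frechet_derivative g (at x) h)
      + B (frechet_derivative f (at x) h) (g x))" for h
    using Suc.prems by (intro Ck_on_add[OF assms(1)] Suc.IH) auto
  then show ?case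
    by (intro Ck_on_SucI[OF assms(1) bounded_bilinear.FDERIV[OF assms(2) Ck_on_SucD1 Ck_on_SucD1]])
      (use Suc.prems in auto)
qed

lemma Ck_on_inverse:
  fixes f :: "'a::euclidean_space \<Rightarrow> real"
  assumes "open U" "Ck_on n U f" "\<And>x. x \<in> U \<Longrightarrow> f x \<noteq> 0"
  shows "Ck_on n U (\<lambda>x. inverse (f x))"
  using assms(2)
proof (induction n)
  case 0
  then show ?case
    using assms(3) by (simp add: continuous_on_inverse)
next
  case (Suc n)
  have IH: "Ck_on n U (\<lambda>x. inverse (f x))"
    using Suc Ck_on_Suc_imp by blast
  have "Ck_on n U (\<lambda>x. (-1) * (inverse (f x) * frechet_derivative f (at x) h * inverse (f x)))" for h
    by (intro Ck_on_bilinear[OF assms(1) bounded_bilinear_mult] Ck_on_const IH)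
      (use Suc.prems in simp)
  then show ?case
    by (intro Ck_on_SucI[OF assms(1) Deriv.has_derivative_inverse[OF _ Ck_on_SucD1]])
      (use Suc.prems assms(3) in auto)
qed

lemma Ck_on_compose_linear:
  assumes "open U" "bounded_linear L" "Ck_on n U f"
  shows "Ck_on n U (\<lambda>x. L (f x))"
  using assms(3)
proof (induction n arbitrary: f)
  case 0
  then show ?case
    by (simp add: bounded_linear.continuous_on[OF assms(2)])
next
  case (Suc n)
  show ?case
    by (rule Ck_on_SucI[OF assms(1) bounded_linear.has_derivative[OF assms(2) Ck_on_SucD1]])
      (use Suc in auto)
qed

lemma smooth_on_cong:
  "open U \<Longrightarrow> smooth_on U f \<Longrightarrow> (\<And>x. x \<in> U \<Longrightarrow> f x = g x) \<Longrightarrow> smooth_on U g"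
  unfolding smooth_on_def using Ck_on_cong by metis

lemma smooth_on_linear: "open U \<Longrightarrow> bounded_linear f \<Longrightarrow> smooth_on U f"
  by (simp add: smooth_on_def Ck_on_linear)

lemma smooth_on_const: "smooth_on U (\<lambda>x. c)"
  by (simp add: smooth_on_def Ck_on_const)

lemma smooth_on_bilinear:
  "open U \<Longrightarrow> bounded_bilinear B \<Longrightarrow> smooth_on U f \<Longrightarrow> smooth_on U g \<Longrightarrow> smooth_on U (\<lambda>x. B (f x) (g x))"
  by (simp add: smooth_on_def Ck_on_bilinear)

lemma smooth_on_inverse:
  fixes f :: "'a::euclidean_space \<Rightarrow> real"
  shows "open U \<Longrightarrow> smooth_on U f \<Longrightarrow> (\<And>x. x \<in> U \<Longrightarrow> f x \<noteq> 0) \<Longrightarrow> smooth_on U (\<lambda>x. inverse (f x))"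
  by (simp add: smooth_on_def Ck_on_inverse)

lemma smooth_on_add:
  "open U \<Longrightarrow> smooth_on U f \<Longrightarrow> smooth_on U g \<Longrightarrow> smooth_on U (\<lambda>x. f x + g x)"
  by (simp add: smooth_on_def Ck_on_add)

lemma smooth_on_compose_linear:
  "open U \<Longrightarrow> bounded_linear L \<Longrightarrow> smooth_on U f \<Longrightarrow> smooth_on U (\<lambda>x. L (f x))"
  by (simp add: smooth_on_def Ck_on_compose_linear)

lemma smooth_on_diff:
  assumes "open U" "smooth_on U f" "smooth_on U g"
  shows "smooth_on U (\<lambda>x. f x - g x)"
proof -
  have "smooth_on U (\<lambda>x. f x + (-1) *\<^sub>R g x)"
    by (intro smooth_on_add smooth_on_bilinear[OF _ bounded_bilinear_scaleR] smooth_on_const assms)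
  then show ?thesis
    by simp
qed

lemma smooth_on_sum:
  assumes "open U" "finite A" "\<And>a. a \<in> A \<Longrightarrow> smooth_on U (f a)"
  shows "smooth_on U (\<lambda>x. \<Sum>a\<in>A. f a x)"
  using assms(2,3) by (induction A) (auto intro: smooth_on_add smooth_on_const assms(1))

lemma smooth_on_has_derivative:
  "smooth_on U f \<Longrightarrow> x \<in> U \<Longrightarrow> (f has_derivative frechet_derivative f (at x)) (at x)"
  unfolding smooth_on_def using Ck_on_SucD1 by blast

lemma smooth_on_frechet_derivative:
  "smooth_on U f \<Longrightarrow> smooth_on U (\<lambda>x. frechet_derivative f (at x) h)"
  unfolding smooth_on_def using Ck_on_SucD2 by blast

lemma smooth_on_continuous: "smooth_on U f \<Longrightarrow> continuous_on U f"
  unfolding smooth_on_def using Ck_on.simps(1) by blast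

definition along :: "('a::real_normed_vector \<Rightarrow> 'a) \<Rightarrow> ('a \<Rightarrow> 'b::real_normed_vector) \<Rightarrow> 'a \<Rightarrow> 'b" where
  "along t f x = frechet_derivative f (at x) (t x)"

lemma along_eq: "(f has_derivative f') (at x) \<Longrightarrow> along t f x = f' (t x)"
  unfolding along_def using frechet_derivative_at by metis

lemma along_cong:
  assumes "f differentiable (at x)" "open U" "x \<in> U" "\<And>y. y \<in> U \<Longrightarrow> f y = g y"
  shows "along t f x = along t g x"
  unfolding along_def using frechet_derivative_transform_within_open[OF assms] by simp

lemma along_basis_expansion:
  fixes f :: "'a::euclidean_space \<Rightarrow> 'b::real_normed_vector"
  assumes "(f has_derivative f') (at x)"
  shows "along t f x = (\<Sum>b\<in>Basis. (t x \<bullet> b) *\<^sub>R frechet_derivative f (at x) b)"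
proof -
  have lin: "linear f'"
    using assms by (rule has_derivative_linear)
  have "f' (t x) = f' (\<Sum>b\<in>Basis. (t x \<bullet> b) *\<^sub>R b)"
    by (simp add: euclidean_representation)
  also have "\<dots> = (\<Sum>b\<in>Basis. (t x \<bullet> b) *\<^sub>R f' b)"
    by (simp add: linear_sum[OF lin] linear_scale[OF lin])
  finally show ?thesis
    using frechet_derivative_at[OF assms] along_eq[OF assms] by metis
qed

text \<open>Expanding the direction in a basis reduces the derivative along a varying direction to
  derivatives in constant directions, for which smoothness is built into the definition.\<close>

lemma smooth_on_along:
  fixes f :: "'a::euclidean_space \<Rightarrow> 'b::real_normed_vector"
  assumes "open U" "smooth_on U f" "smooth_on U t"
  shows "smooth_on U (along t f)"
proof (rule smooth_on_cong[OF assms(1)])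
  show "smooth_on U (\<lambda>x. \<Sum>b\<in>Basis. (t x \<bullet> b) *\<^sub>R frechet_derivative f (at x) b)"
    by (intro smooth_on_sum smooth_on_bilinear[OF _ bounded_bilinear_scaleR]
        smooth_on_bilinear[OF _ bounded_bilinear_inner] smooth_on_frechet_derivative smooth_on_const assms)
      simp
  show "(\<Sum>b\<in>Basis. (t x \<bullet> b) *\<^sub>R frechet_derivative f (at x) b) = along t f x" if "x \<in> U" for x
    using along_basis_expansion[OF smooth_on_has_derivative[OF assms(2) that]] by simp
qed

lemma curve_has_derivative:
  fixes f :: "'a::real_normed_vector \<Rightarrow> 'b::real_normed_vector"
  assumes "(f has_derivative f') (at (x + e *\<^sub>R h))"
  shows "((\<lambda>e. f (x + e *\<^sub>R h)) has_vector_derivative f' h) (at e)"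
proof -
  have lin: "linear f'"
    using assms by (rule has_derivative_linear)
  have "((\<lambda>e. x + e *\<^sub>R h) has_derivative (\<lambda>d. d *\<^sub>R h)) (at e)"
    by (auto intro!: derivative_eq_intros)
  from has_derivative_compose[OF this assms] show ?thesis
    unfolding has_vector_derivative_def by (simp add: linear_scale[OF lin])
qed

text \<open>The mean value theorem in the direction \<open>h\<close> and then in the direction \<open>k\<close>. The left-hand
  side is symmetric in the two directions and the right-hand side is not, which forces mixed second
  derivatives to commute.\<close>

lemma mixed_difference_quotient:
  fixes f :: "'a::real_normed_vector \<Rightarrow> real"
  assumes "0 < e"
    and sub: "\<And>r s. 0 \<le> r \<Longrightarrow> r \<le> e \<Longrightarrow> 0 \<le> s \<Longrightarrow> s \<le> e \<Longrightarrow> x + r *\<^sub>R h + s *\<^sub>R k \<in> U"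
    and f: "\<And>y. y \<in> U \<Longrightarrow> (f has_derivative f' y) (at y)"
    and f': "\<And>y. y \<in> U \<Longrightarrow> ((\<lambda>y. f' y h) has_derivative f'' y) (at y)"
  shows "\<exists>r s. 0 \<le> r \<and> r \<le> e \<and> 0 \<le> s \<and> s \<le> e \<and>
    f (x + e *\<^sub>R h + e *\<^sub>R k) - f (x + e *\<^sub>R h) - f (x + e *\<^sub>R k) + f x
      = e\<^sup>2 * f'' (x + r *\<^sub>R h + s *\<^sub>R k) k"
proof -
  define \<phi> where "\<phi> r = f (x + e *\<^sub>R k + r *\<^sub>R h) - f (x + r *\<^sub>R h)" for r
  have "(\<phi> has_real_derivative f' (x + e *\<^sub>R k + r *\<^sub>R h) h - f' (x + r *\<^sub>R h) h) (at r)"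
    if "0 \<le> r" "r \<le> e" for r
    unfolding \<phi>_def has_real_derivative_iff_has_vector_derivative
    using sub[of r e] sub[of r 0] that \<open>0 < e\<close>
    by (intro has_vector_derivative_diff curve_has_derivative f) (auto simp: algebra_simps)
  from MVT2[OF \<open>0 < e\<close> this] obtain r where r: "0 < r" "r < e"
    "\<phi> e - \<phi> 0 = e * (f' (x + e *\<^sub>R k + r *\<^sub>R h) h - f' (x + r *\<^sub>R h) h)"
    by auto
  have "((\<lambda>s. f' (x + r *\<^sub>R h + s *\<^sub>R k) h) has_real_derivative f'' (x + r *\<^sub>R h + s *\<^sub>R k) k) (at s)"
    if "0 \<le> s" "s \<le> e" for s
    unfolding has_real_derivative_iff_has_vector_derivative
    using sub[of r s] that r by (intro curve_has_derivative f') auto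
  from MVT2[OF \<open>0 < e\<close> this] obtain s where s: "0 < s" "s < e"
    "f' (x + r *\<^sub>R h + e *\<^sub>R k) h - f' (x + r *\<^sub>R h) h = e * f'' (x + r *\<^sub>R h + s *\<^sub>R k) k"
    by auto
  have "f (x + e *\<^sub>R h + e *\<^sub>R k) - f (x + e *\<^sub>R h) - f (x + e *\<^sub>R k) + f x = \<phi> e - \<phi> 0"
    by (simp add: \<phi>_def algebra_simps)
  also have "\<dots> = e * (f' (x + r *\<^sub>R h + e *\<^sub>R k) h - f' (x + r *\<^sub>R h) h)"
    using r by (simp add: algebra_simps)
  also have "\<dots> = e\<^sup>2 * f'' (x + r *\<^sub>R h + s *\<^sub>R k) k"
    using s by (simp add: power2_eq_square)
  finally show ?thesis
    using r s by (intro exI[of _ r] exI[of _ s]) simp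
qed

text \<open>Both mixed derivatives are the limit of the same second difference quotient.\<close>

lemma second_derivative_symmetric_real:
  fixes f :: "'a::euclidean_space \<Rightarrow> real"
  assumes "open U" "smooth_on U f" "x \<in> U"
  shows "along (\<lambda>_. k) (along (\<lambda>_. h) f) x = along (\<lambda>_. h) (along (\<lambda>_. k) f) x"
proof -
  define \<Delta> where "\<Delta> e = (f (x + e *\<^sub>R h + e *\<^sub>R k) - f (x + e *\<^sub>R h) - f (x + e *\<^sub>R k) + f x) / e\<^sup>2" for e :: real
  have lim: "(\<Delta> \<longlongrightarrow> along (\<lambda>_. k) (along (\<lambda>_. h) f) x) (at_right 0)"
    if \<Delta>: "\<And>e. \<Delta> e = (f (x + e *\<^sub>R h + e *\<^sub>R k) - f (x + e *\<^sub>R h) - f (x + e *\<^sub>R k) + f x) / e\<^sup>2"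
    for h k \<Delta>
  proof -
    define g where "g = along (\<lambda>_. k) (along (\<lambda>_. h) f)"
    have "smooth_on U g"
      unfolding g_def by (intro smooth_on_along smooth_on_const assms)
    then have g: "isCont g x"
      using smooth_on_continuous assms continuous_on_eq_continuous_at by blast
    show ?thesis
      unfolding g_def[symmetric]
    proof (rule tendstoI)
      fix c :: real assume "0 < c"
      have "\<forall>\<^sub>F y in nhds x. dist (g y) (g x) < c"
        using g \<open>0 < c\<close> unfolding isCont_def
        by (metis continuous_at g isCont_def tendstoD tendsto_at_iff_tendsto_nhds)
      moreover have "\<forall>\<^sub>F y in nhds x. y \<in> U"
        using assms eventually_nhds_in_open by blast
      ultimately have "\<forall>\<^sub>F y in nhds x. dist (g y) (g x) < c \<and> y \<in> U"
        by eventually_elim simp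
      then obtain d where "0 < d" and d: "\<And>y. dist y x < d \<Longrightarrow> dist (g y) (g x) < c \<and> y \<in> U"
        unfolding eventually_nhds_metric by blast
      \<comment> \<open>The summand 1 only keeps the denominator positive.\<close>
      define b where "b = d / (norm h + norm k + 1)"
      have "0 < b"
        unfolding b_def using \<open>0 < d\<close> by (intro divide_pos_pos) (auto intro: add_nonneg_pos)
      have "dist (\<Delta> e) (g x) < c" if e: "0 < e" "e < b" for e
      proof -
        have near: "dist (x + r *\<^sub>R h + s *\<^sub>R k) x < d" if "0 \<le> r" "r \<le> e" "0 \<le> s" "s \<le> e" for r s
        proof -
          have "dist (x + r *\<^sub>R h + s *\<^sub>R k) x = norm (r *\<^sub>R h + s *\<^sub>R k)"
            by (simp add: dist_norm)
          also have "\<dots> \<le> r * norm h + s * norm k"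
            using norm_triangle_ineq[of "r *\<^sub>R h" "s *\<^sub>R k"] that by simp
          also have "\<dots> \<le> e * norm h + e * norm k"
            using that by (intro add_mono mult_right_mono) auto
          also have "\<dots> < e * (norm h + norm k + 1)"
            using e by (simp add: algebra_simps)
          also have "\<dots> \<le> d"
            using e \<open>0 < b\<close> unfolding b_def
            by (smt (verit, best) divide_le_eq norm_ge_zero pos_less_divide_eq)
          finally show ?thesis .
        qed
        obtain r s where rs: "0 \<le> r" "r \<le> e" "0 \<le> s" "s \<le> e" and
          "f (x + e *\<^sub>R h + e *\<^sub>R k) - f (x + e *\<^sub>R h) - f (x + e *\<^sub>R k) + f x
            = e\<^sup>2 * frechet_derivative (\<lambda>y. frechet_derivative f (at y) h) (at (x + r *\<^sub>R h + s *\<^sub>R k)) k"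
          using mixed_difference_quotient[of e x h k U f "\<lambda>y. frechet_derivative f (at y)"
              "\<lambda>z. frechet_derivative (\<lambda>y. frechet_derivative f (at y) h) (at z)"]
          using e near d smooth_on_has_derivative[OF assms(2)]
            smooth_on_has_derivative[OF smooth_on_frechet_derivative[OF assms(2)]]
          by blast
        then have "\<Delta> e = g (x + r *\<^sub>R h + s *\<^sub>R k)"
          using e by (simp add: \<Delta> g_def along_def[abs_def])
        then show ?thesis
          using d[OF near[OF rs]] by simp
      qed
      then show "\<forall>\<^sub>F e in at_right 0. dist (\<Delta> e) (g x) < c"
        using \<open>0 < b\<close> eventually_at_right_field by blast
    qed
  qed
  have "(\<Delta> \<longlongrightarrow> along (\<lambda>_. k) (along (\<lambda>_. h) f) x) (at_right 0)"
    by (rule lim) (simp add: \<Delta>_def)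
  moreover have "(\<Delta> \<longlongrightarrow> along (\<lambda>_. h) (along (\<lambda>_. k) f) x) (at_right 0)"
    by (rule lim) (simp add: \<Delta>_def algebra_simps)
  ultimately show ?thesis
    using tendsto_unique trivial_limit_at_right_real by blast
qed

lemma along_compose_linear:
  assumes "bounded_linear L" "(f has_derivative f') (at x)"
  shows "along t (\<lambda>x. L (f x)) x = L (along t f x)"
  using along_eq[OF bounded_linear.has_derivative[OF assms]] along_eq[OF assms(2)] by metis

lemma second_derivative_symmetric:
  fixes f :: "'a::euclidean_space \<Rightarrow> 'b::euclidean_space"
  assumes "open U" "smooth_on U f" "x \<in> U"
  shows "along (\<lambda>_. k) (along (\<lambda>_. h) f) x = along (\<lambda>_. h) (along (\<lambda>_. k) f) x"
proof (rule euclidean_eqI)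
  fix b :: 'b
  have inner: "bounded_linear (\<lambda>y. y \<bullet> b)"
    by (rule bounded_linear_inner_left)
  have *: "along (\<lambda>_. k) (along (\<lambda>_. h) f) x \<bullet> b = along (\<lambda>_. k) (along (\<lambda>_. h) (\<lambda>y. f y \<bullet> b)) x" for h k
  proof -
    have sm: "smooth_on U (along (\<lambda>_. h) f)"
      by (intro smooth_on_along smooth_on_const assms)
    have "along (\<lambda>_. k) (along (\<lambda>_. h) f) x \<bullet> b = along (\<lambda>_. k) (\<lambda>y. along (\<lambda>_. h) f y \<bullet> b) x"
      using along_compose_linear[OF inner smooth_on_has_derivative[OF sm assms(3)]] by simp
    also have "\<dots> = along (\<lambda>_. k) (along (\<lambda>_. h) (\<lambda>y. f y \<bullet> b)) x"
    proof (rule along_cong[OF _ assms(1,3)])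
      show "(\<lambda>y. along (\<lambda>_. h) f y \<bullet> b) differentiable at x"
        using bounded_linear.has_derivative[OF inner smooth_on_has_derivative[OF sm assms(3)]]
        by (auto simp: differentiable_def)
      show "along (\<lambda>_. h) f y \<bullet> b = along (\<lambda>_. h) (\<lambda>y. f y \<bullet> b) y" if "y \<in> U" for y
        using along_compose_linear[OF inner smooth_on_has_derivative[OF assms(2) that]] by simp
    qed
    finally show ?thesis .
  qed
  show "along (\<lambda>_. k) (along (\<lambda>_. h) f) x \<bullet> b = along (\<lambda>_. h) (along (\<lambda>_. k) f) x \<bullet> b"
    unfolding *
    by (rule second_derivative_symmetric_real[OF assms(1)
          smooth_on_compose_linear[OF assms(1) inner assms(2)] assms(3)])
qed

text \<open>The second-order part of an iterated derivative along fields sees only the values of the fields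
  at the point; the remainder is of first order. Symmetry of the second-order part then leaves only
  first-order terms in the commutator.\<close>

lemma along_along:
  fixes f :: "'a::euclidean_space \<Rightarrow> 'b::euclidean_space"
  assumes "open U" "smooth_on U f" "smooth_on U t" "x \<in> U"
  shows "along s (along t f) x
    = along (\<lambda>_. s x) (along (\<lambda>_. t x) f) x + frechet_derivative f (at x) (along s t x)"
proof -
  let ?F = "frechet_derivative f"
  define D where "D b = frechet_derivative (\<lambda>y. ?F (at y) b) (at x)" for b
  have D: "((\<lambda>y. ?F (at y) b) has_derivative D b) (at x)" for b
    unfolding D_def by (rule smooth_on_has_derivative[OF smooth_on_frechet_derivative[OF assms(2)] assms(4)])
  define T where "T = frechet_derivative t (at x)"
  have T: "(t has_derivative T) (at x)"
    unfolding T_def by (rule smooth_on_has_derivative[OF assms(3,4)])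
  have lin: "linear (?F (at x))"
    using smooth_on_has_derivative[OF assms(2,4)] by (rule has_derivative_linear)
  have "((\<lambda>y. \<Sum>b\<in>Basis. (t y \<bullet> b) *\<^sub>R ?F (at y) b) has_derivative
      (\<lambda>h. \<Sum>b\<in>Basis. (t x \<bullet> b) *\<^sub>R D b h + (T h \<bullet> b) *\<^sub>R ?F (at x) b)) (at x)"
    if "(t has_derivative T) (at x)" for t T
    by (intro has_derivative_sum has_derivative_scaleR D has_derivative_inner_left that)
  note expand = this
  have eq: "along s (along t f) x = (\<Sum>b\<in>Basis. (t x \<bullet> b) *\<^sub>R D b (s x) + (T' (s x) \<bullet> b) *\<^sub>R ?F (at x) b)"
    if t: "(t has_derivative T') (at x)" for t T' s
  proof -
    have "along s (along t f) x = along s (\<lambda>y. \<Sum>b\<in>Basis. (t y \<bullet> b) *\<^sub>R ?F (at y) b) x"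
      using along_cong[of "\<lambda>y. \<Sum>b\<in>Basis. (t y \<bullet> b) *\<^sub>R ?F (at y) b" x U "along t f" s]
        along_basis_expansion[OF smooth_on_has_derivative[OF assms(2)]] expand[OF t] assms(1,4)
      by (metis (no_types, lifting) differentiableI)
    then show ?thesis
      using along_eq[OF expand[OF t]] by simp
  qed
  have "along (\<lambda>_. s x) (along (\<lambda>_. t x) f) x = (\<Sum>b\<in>Basis. (t x \<bullet> b) *\<^sub>R D b (s x))"
    by (subst eq[OF has_derivative_const]) simp
  moreover have "?F (at x) (T (s x)) = (\<Sum>b\<in>Basis. (T (s x) \<bullet> b) *\<^sub>R ?F (at x) b)"
    by (metis (no_types, lifting) euclidean_representation linear_sum[OF lin] linear_scale[OF lin] sum.cong)
  ultimately show ?thesis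
    using eq[OF T, of s] along_eq[OF T, of s] by (simp add: sum.distrib)
qed

lemma along_commutator:
  fixes f :: "'a::euclidean_space \<Rightarrow> 'b::euclidean_space"
  assumes "open U" "smooth_on U f" "smooth_on U s" "smooth_on U t" "x \<in> U"
  shows "along s (along t f) x - along t (along s f) x
    = frechet_derivative f (at x) (along s t x - along t s x)"
proof -
  have lin: "linear (frechet_derivative f (at x))"
    using smooth_on_has_derivative[OF assms(2,5)] by (rule has_derivative_linear)
  show ?thesis
    using along_along[OF assms(1,2,4,5), of s] along_along[OF assms(1,2,3,5), of t]
      second_derivative_symmetric[OF assms(1,2,5), of "s x" "t x"]
    by (simp add: linear_diff[OF lin])
qed

section \<open>The scalars\<close>

lemma conj_zero [simp]: "conj (0::'k::rch_algebra) = 0"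
  using conj_add[of "0::'k" 0] by simp

lemma conj_minus: "conj (- x::'k::rch_algebra) = - conj x"
  using conj_scaleR[of "-1" x] by simp

lemma conj_diff: "conj (x - y::'k::rch_algebra) = conj x - conj y"
  using conj_add[of x "- y"] by (simp add: conj_minus)

lemma re_linear: "re (x + y) = re x + re y" "re (x - y) = re x - re y" "re (r *\<^sub>R x) = r * re x"
  "re (- x) = - re x" "re (0::'k::rch_algebra) = 0" "re (1::'k) = 1" "re (of_real r::'k) = r"
  by (simp_all add: re_def inner_simps of_real_def power2_norm_eq_inner[symmetric])

lemma add_conj: "x + conj x = of_real (2 * re x)" for x :: "'k::rch_algebra"
  by (simp add: conj_plus_self re_def of_real_def)

lemma conj_eq: "conj x = (2 * re x) *\<^sub>R 1 - x" for x :: "'k::rch_algebra"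
  using conj_plus_self[of x] by (simp add: re_def algebra_simps)

lemma conj_of_real [simp]: "conj (of_real r :: 'k::rch_algebra) = of_real r"
  by (simp add: conj_eq re_linear of_real_def scaleR_left_diff_distrib[symmetric])

lemma re_conj [simp]: "re (conj x) = re x" for x :: "'k::rch_algebra"
  by (simp add: conj_eq re_linear)

lemma self_conj_real: "conj x = x \<Longrightarrow> x = of_real (re x)" for x :: "'k::rch_algebra"
  using conj_plus_self[of x]
  by (simp add: re_def[symmetric] of_real_def scaleR_2[symmetric] scaleR_scaleR[symmetric] del: scaleR_scaleR)

text \<open>Polarization of the identity between \<^term>\<open>conj x * x\<close> and the squared norm.\<close>

lemma inner_eq_re: "x \<bullet> y = re (conj x * y)" for x y :: "'k::rch_algebra"
proof -
  have sq: "conj z * z = of_real (z \<bullet> z)" for z :: 'k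
    by (simp add: conj_mult_self of_real_def power2_norm_eq_inner)
  have "conj (x + y) * (x + y) = conj x * x + conj y * y + (conj x * y + conj (conj x * y))"
    by (simp add: conj_add conj_mult conj_conj algebra_simps)
  then have "of_real ((x + y) \<bullet> (x + y)) = (of_real (x \<bullet> x + y \<bullet> y + 2 * re (conj x * y)) :: 'k)"
    unfolding sq add_conj by simp
  then show ?thesis
    unfolding of_real_eq_iff by (simp add: inner_simps inner_commute)
qed

lemma inner_conj: "conj x \<bullet> conj y = x \<bullet> y" for x y :: "'k::rch_algebra"
  unfolding conj_eq by (simp add: inner_simps of_real_def re_def power2_norm_eq_inner[symmetric] inner_commute)

text \<open>Conjugation is an isometry, being the reflection in the real axis; comparing the inner products
  of \<open>x\<close>, \<^term>\<open>conj y\<close> with those of their conjugates exchanges the order of the factors.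
  For the quaternions this takes the place of commutativity.\<close>

lemma re_mult_commute: "re (x * y) = re (y * x)" for x y :: "'k::rch_algebra"
  using inner_conj[of "conj x" y] inner_commute[of x "conj y"]
  by (simp add: inner_eq_re conj_conj)

lemma mult_conj_self: "x * conj x = of_real ((norm x)\<^sup>2)" for x :: "'k::rch_algebra"
proof -
  have "norm (conj x) = norm x"
    by (simp add: norm_eq_sqrt_inner inner_conj)
  then show ?thesis
    using conj_mult_self[of "conj x"] by (simp add: conj_conj of_real_def)
qed

lemma re_square: "re (x * x) = 2 * (re x)\<^sup>2 - (norm x)\<^sup>2" for x :: "'k::rch_algebra"
proof -
  have "re (x * x) = conj x \<bullet> x"
    by (simp add: inner_eq_re conj_conj)
  then show ?thesis
    by (simp add: conj_eq inner_simps of_real_def re_def power2_norm_eq_inner) (simp add: power2_eq_square)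
qed

lemma norm_minus_conj: "(norm (x - conj x))\<^sup>2 = 4 * ((norm x)\<^sup>2 - (re x)\<^sup>2)" for x :: "'k::rch_algebra"
proof -
  have "(1::'k) \<bullet> 1 = 1"
    by (simp add: power2_norm_eq_inner[symmetric])
  then have "(x - conj x) \<bullet> (x - conj x) = 4 * (x \<bullet> x - (1 \<bullet> x)\<^sup>2)"
    by (simp add: conj_eq inner_simps re_def inner_commute[of x 1] power2_eq_square algebra_simps)
  then show ?thesis
    by (simp add: power2_norm_eq_inner re_def)
qed

lemma re_mult_nondegenerate:
  fixes x :: "'k::rch_algebra"
  assumes "\<And>k. re (x * k) = 0"
  shows "x = 0"
  using assms[of "conj x"] unfolding mult_conj_self re_linear by simp

lemma of_real_comm: "of_real r * x = x * (of_real r :: 'k::rch_algebra)"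
  by (simp add: of_real_def)

section \<open>Hermitian spaces\<close>

context hermitian_space
begin

lemma act_scaleR_right: "v \<cdot> (r *\<^sub>R k) = r *\<^sub>R (v \<cdot> k)"
  using act_mult[of v k "of_real r"] by (simp add: act_of_real scaleR_conv_of_real of_real_comm)

lemma act_scaleR_left: "(r *\<^sub>R v) \<cdot> k = r *\<^sub>R (v \<cdot> k)"
  using act_mult[of v "of_real r" k] by (simp add: act_of_real act_scaleR_right scaleR_conv_of_real[symmetric])

lemma herm_scaleR_right: "\<langle>v, r *\<^sub>R w\<rangle> = r *\<^sub>R \<langle>v, w\<rangle>"
  using herm_act_right[of v w "of_real r"] by (simp add: act_of_real scaleR_conv_of_real of_real_comm)

lemma herm_scaleR_left: "\<langle>r *\<^sub>R v, w\<rangle> = r *\<^sub>R \<langle>v, w\<rangle>"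
  using herm_act_left[of v "of_real r" w] by (simp add: act_of_real scaleR_conv_of_real)

sublocale act: bounded_bilinear act
  by (subst bilinear_conv_bounded_bilinear[symmetric])
    (auto simp: bilinear_def act_add_left act_add_right act_scaleR_left act_scaleR_right intro!: linearI)

sublocale herm: bounded_bilinear herm
  by (subst bilinear_conv_bounded_bilinear[symmetric])
    (auto simp: bilinear_def herm_add_left herm_add_right herm_scaleR_left herm_scaleR_right intro!: linearI)

lemma act_inverse: "k \<noteq> 0 \<Longrightarrow> v \<cdot> k \<cdot> inverse k = v"
  by (metis act_mult act_one right_inverse)

lemma herm_self: "\<langle>v, v\<rangle> = of_real (re \<langle>v, v\<rangle>)"
  by (rule self_conj_real) (simp add: herm_conj[symmetric])

lemma act_herm_self: "w \<cdot> (\<langle>v, v\<rangle> * k) = re \<langle>v, v\<rangle> *\<^sub>R (w \<cdot> k)"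
  by (subst herm_self) (simp add: scaleR_conv_of_real[symmetric] act_scaleR_right)

lemma herm_zero_commute: "\<langle>v, w\<rangle> = 0 \<longleftrightarrow> \<langle>w, v\<rangle> = 0"
  by (metis herm_conj conj_zero)

lemma re_herm_commute: "re \<langle>v, w\<rangle> = re \<langle>w, v\<rangle>"
  by (metis herm_conj re_conj)

lemma herm_nondegenerate_right: "(\<And>w. \<langle>w, v\<rangle> = 0) \<Longrightarrow> v = 0"
  using herm_nondegenerate herm_zero_commute by blast

text \<open>Replacing \<open>w\<close> by \<open>w \<cdot> k\<close> recovers all components of \<open>\<langle>v, w\<rangle>\<close> from real
  parts, so testing against real parts suffices.\<close>

lemma re_herm_nondegenerate:
  assumes "\<And>w. re \<langle>v, w\<rangle> = 0"
  shows "v = 0"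
proof (rule herm_nondegenerate, rule re_mult_nondegenerate)
  show "re (\<langle>v, w\<rangle> * k) = 0" for w k
    using assms[of "w \<cdot> k"] by (simp add: herm_act_right)
qed

definition nonnull :: "'v set" where
  "nonnull = {v. \<langle>v, v\<rangle> \<noteq> 0}"

lemma nonnull_iff: "v \<in> nonnull \<longleftrightarrow> re \<langle>v, v\<rangle> \<noteq> 0"
  unfolding nonnull_def by (subst herm_self) simp

lemma open_nonnull: "open nonnull"
proof -
  have "continuous_on UNIV (\<lambda>v. \<langle>v, v\<rangle>)"
    by (intro herm.continuous_on continuous_on_id)
  then show ?thesis
    unfolding nonnull_def by (intro open_Collect_neq) auto
qed

lemma herm_self_act: "\<langle>v \<cdot> k, v \<cdot> k\<rangle> = of_real (re \<langle>v, v\<rangle> * (norm k)\<^sup>2)"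
proof -
  have "\<langle>v \<cdot> k, v \<cdot> k\<rangle> = conj k * (of_real (re \<langle>v, v\<rangle>) * k)"
    by (simp add: herm_act_left herm_act_right herm_self[symmetric] mult.assoc)
  also have "\<dots> = of_real (re \<langle>v, v\<rangle>) * (conj k * k)"
    by (simp add: of_real_def)
  finally show ?thesis
    by (simp add: conj_mult_self of_real_def)
qed

lemma re_herm_self_act: "re \<langle>v \<cdot> k, v \<cdot> k\<rangle> = re \<langle>v, v\<rangle> * (norm k)\<^sup>2"
  by (simp only: herm_self_act re_linear)

lemma nonnull_act: "v \<in> nonnull \<Longrightarrow> k \<noteq> 0 \<Longrightarrow> v \<cdot> k \<in> nonnull"
  unfolding nonnull_iff re_herm_self_act by simp

lemma nonnull_nonzero: "v \<in> nonnull \<Longrightarrow> v \<noteq> 0"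
  by (auto simp: nonnull_def herm.zero_left)

lemma mem_line: "v \<in> line v"
  unfolding line_def by (metis act_one rangeI)

lemma line_act:
  assumes "k \<noteq> 0"
  shows "line (v \<cdot> k) = line v"
proof -
  have "v \<cdot> l = v \<cdot> k \<cdot> (inverse k * l)" for l
    using assms by (simp add: act_mult act_inverse)
  then show ?thesis
    unfolding line_def by (auto simp: act_mult[symmetric] image_iff)
qed

lemma line_eqE:
  assumes "line v = line w" "w \<noteq> 0"
  obtains k where "k \<noteq> 0" "v = w \<cdot> k"
proof -
  obtain k where k: "v = w \<cdot> k"
    using mem_line[of v] assms(1) unfolding line_def by auto
  have "v \<noteq> 0"
    using assms mem_line[of w] unfolding line_def by (auto simp: act.zero_left)
  then have "k \<noteq> 0"
    using k by (auto simp: act.zero_right)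
  then show ?thesis
    using k that by blast
qed

lemma line_nonisotropic: "line v \<in> nonisotropic_points \<longleftrightarrow> v \<in> nonnull"
proof
  assume L: "line v \<in> nonisotropic_points"
  then obtain w where "line v = line w" "w \<noteq> 0"
    unfolding nonisotropic_points_def proj_space_def by auto
  then have "v \<noteq> 0"
    using mem_line[of w] by (auto simp: line_def act.zero_left)
  then show "v \<in> nonnull"
    using L unfolding nonisotropic_points_def isotropic_points_def nonnull_def by auto
next
  assume v: "v \<in> nonnull"
  have "line v \<notin> isotropic_points"
  proof
    assume "line v \<in> isotropic_points"
    then obtain w where w: "\<langle>w, w\<rangle> = 0" "line w = line v"
      unfolding isotropic_points_def by auto
    then obtain k where "k \<noteq> 0" "w = v \<cdot> k"
      using line_eqE nonnull_nonzero[OF v] by metis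
    then show False
      using w nonnull_act[OF v] by (simp add: nonnull_def)
  qed
  then show "line v \<in> nonisotropic_points"
    using nonnull_nonzero[OF v] by (simp add: nonisotropic_points_def proj_space_def)
qed

lemma nonisotropic_lift: "{v. line v \<in> nonisotropic_points} = nonnull"
  by (simp add: line_nonisotropic)

lemma nonisotropicE:
  assumes "L \<in> nonisotropic_points"
  obtains v where "v \<in> nonnull" "L = line v"
  using assms line_nonisotropic unfolding nonisotropic_points_def proj_space_def by blast

lemma perp_line: "w \<in> perp (line v) \<longleftrightarrow> \<langle>v, w\<rangle> = 0"
proof
  show "w \<in> perp (line v) \<Longrightarrow> \<langle>v, w\<rangle> = 0"
    unfolding perp_def using mem_line by blast
  show "\<langle>v, w\<rangle> = 0 \<Longrightarrow> w \<in> perp (line v)"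
    unfolding perp_def line_def by (auto simp: herm_act_left)
qed

text \<open>Only used for nonisotropic \<open>v\<close>, where it is the projection onto the orthogonal complement of
  \<open>v\<close> along the line of \<open>v\<close>.\<close>

definition hproj :: "'v \<Rightarrow> 'v \<Rightarrow> 'v" where
  "hproj v w = w - (v \<cdot> \<langle>v, w\<rangle>) /\<^sub>R re \<langle>v, v\<rangle>"

lemma linear_hproj: "linear (hproj v)"
  unfolding hproj_def
  by (rule linearI) (simp_all add: herm_add_right herm_scaleR_right act_add_right act_scaleR_right algebra_simps)

lemma herm_hproj:
  assumes "v \<in> nonnull"
  shows "\<langle>v, hproj v w\<rangle> = 0"
proof -
  have "\<langle>v, v \<cdot> \<langle>v, w\<rangle>\<rangle> = re \<langle>v, v\<rangle> *\<^sub>R \<langle>v, w\<rangle>"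
    by (subst herm_act_right, subst herm_self) (simp add: scaleR_conv_of_real)
  then show ?thesis
    using assms by (simp add: nonnull_iff hproj_def herm.diff_right herm_scaleR_right)
qed

lemma hproj_eq: "\<langle>v, w\<rangle> = 0 \<Longrightarrow> hproj v w = w"
  by (simp add: hproj_def act.zero_right)

lemma hproj_act_self: "v \<in> nonnull \<Longrightarrow> hproj v (v \<cdot> k) = 0"
  by (simp add: hproj_def herm_act_right act_herm_self nonnull_iff)

lemma herm_hproj_right: "\<langle>v, u\<rangle> = 0 \<Longrightarrow> \<langle>u, hproj v w\<rangle> = \<langle>u, w\<rangle>"
  using herm_zero_commute[of v u]
  by (simp add: hproj_def herm.diff_right herm_scaleR_right herm_act_right)

lemma herm_hproj_left: "\<langle>v, u\<rangle> = 0 \<Longrightarrow> \<langle>hproj v w, u\<rangle> = \<langle>w, u\<rangle>"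
  by (simp add: hproj_def herm.diff_left herm_scaleR_left herm_act_left)

lemma hproj_decomp: "w = hproj v w + v \<cdot> (\<langle>v, w\<rangle> /\<^sub>R re \<langle>v, v\<rangle>)"
  by (simp add: hproj_def act_scaleR_right)

lemma hproj_equivariant:
  assumes "k \<noteq> 0"
  shows "hproj (v \<cdot> k) (w \<cdot> l) = hproj v w \<cdot> l"
proof -
  have "k * conj k = of_real ((norm k)\<^sup>2)"
    by (rule mult_conj_self)
  then have "v \<cdot> (k * (conj k * (\<langle>v, w\<rangle> * l))) = (norm k)\<^sup>2 *\<^sub>R (v \<cdot> (\<langle>v, w\<rangle> * l))"
    unfolding mult.assoc[symmetric, of k] by (simp add: scaleR_conv_of_real[symmetric] act_scaleR_right mult.assoc del: of_real_power)
  then show ?thesis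
    using assms unfolding hproj_def re_herm_self_act
    by (simp add: herm_act_left herm_act_right act.diff_left
        act_scaleR_left act_mult[symmetric] mult.assoc)
qed

section \<open>Tangent vectors\<close>

definition outer :: "'v \<Rightarrow> 'v \<Rightarrow> 'v \<Rightarrow>\<^sub>L 'v" where
  "outer v w = Blinfun (\<lambda>x. w \<cdot> \<langle>v, x\<rangle>)"

lemma outer_apply: "blinfun_apply (outer v w) x = w \<cdot> \<langle>v, x\<rangle>"
  unfolding outer_def
  by (intro bounded_linear_Blinfun_apply[THEN fun_cong]
      bounded_linear_compose[OF act.bounded_linear_right herm.bounded_linear_right])

lemma bounded_bilinear_outer: "bounded_bilinear outer"
proof
  show "outer (v + v') w = outer v w + outer v' w" for v v' w
    by (rule blinfun_eqI) (simp add: outer_apply blinfun.add_left herm_add_left act_add_right)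
  show "outer v (w + w') = outer v w + outer v w'" for v w w'
    by (rule blinfun_eqI) (simp add: outer_apply blinfun.add_left act_add_left)
  show "outer (r *\<^sub>R v) w = r *\<^sub>R outer v w" for r v w
    by (rule blinfun_eqI) (simp add: outer_apply blinfun.scaleR_left herm_scaleR_left act_scaleR_right)
  show "outer v (r *\<^sub>R w) = r *\<^sub>R outer v w" for r v w
    by (rule blinfun_eqI) (simp add: outer_apply blinfun.scaleR_left act_scaleR_left)
  obtain K where K: "0 \<le> K" "\<And>w k. norm (w \<cdot> k) \<le> norm w * norm k * K"
    using act.nonneg_bounded by blast
  obtain M where M: "0 \<le> M" "\<And>v x. norm \<langle>v, x\<rangle> \<le> norm v * norm x * M"
    using herm.nonneg_bounded by blast
  have "norm (outer v w) \<le> norm v * norm w * (M * K)" for v w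
  proof (rule norm_blinfun_bound)
    show "0 \<le> norm v * norm w * (M * K)"
      using K M by simp
    fix x
    have "norm (w \<cdot> \<langle>v, x\<rangle>) \<le> norm w * norm \<langle>v, x\<rangle> * K"
      by (rule K)
    also have "\<dots> \<le> norm w * (norm v * norm x * M) * K"
      by (intro mult_right_mono mult_left_mono M K norm_ge_zero)
    finally show "norm (blinfun_apply (outer v w) x) \<le> norm v * norm w * (M * K) * norm x"
      by (simp add: outer_apply ac_simps)
  qed
  then show "\<exists>C. \<forall>v w. norm (outer v w) \<le> norm v * norm w * C"
    by blast
qed

text \<open>The tangent vector at \<^term>\<open>line v\<close> that sends the representative \<open>v\<close> to \<open>w\<close>. For
  nonisotropic \<open>v\<close>, this identifies the orthogonal complement of \<open>v\<close> with the tangent space.\<close>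

definition hor :: "'v \<Rightarrow> 'v \<Rightarrow> 'v \<Rightarrow>\<^sub>L 'v" where
  "hor v w = outer v w /\<^sub>R re \<langle>v, v\<rangle>"

lemma hor_apply: "blinfun_apply (hor v w) x = (w \<cdot> \<langle>v, x\<rangle>) /\<^sub>R re \<langle>v, v\<rangle>"
  by (simp add: hor_def outer_apply blinfun.scaleR_left)

lemma hor_self: "v \<in> nonnull \<Longrightarrow> blinfun_apply (hor v w) v = w"
  using act_herm_self[of w v 1] by (simp add: hor_apply act_one nonnull_iff)

lemma hor_tangent:
  assumes "\<langle>v, w\<rangle> = 0"
  shows "hor v w \<in> tangent_space (line v)"
proof -
  have "\<langle>v, x\<rangle> = 0" if "x \<in> perp (line v)" for x
    using that perp_line by blast
  then show ?thesis
    using assms unfolding tangent_space_def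
    by (auto simp: hor_apply herm_act_right act_mult act_scaleR_left perp_line herm_scaleR_right act.zero_right)
qed

lemma tangent_horizontal: "t \<in> tangent_space (line v) \<Longrightarrow> \<langle>v, blinfun_apply t v\<rangle> = 0"
  unfolding tangent_space_def using mem_line perp_line by blast

lemma tangent_eq_hor:
  assumes "t \<in> tangent_space (line v)" "v \<in> nonnull"
  shows "t = hor v (blinfun_apply t v)"
proof (rule blinfun_eqI)
  fix x
  have "blinfun_apply t x = blinfun_apply t (hproj v x) + blinfun_apply t (v \<cdot> (\<langle>v, x\<rangle> /\<^sub>R re \<langle>v, v\<rangle>))"
    by (subst hproj_decomp[of x v]) (rule blinfun.add_right)
  also have "blinfun_apply t (hproj v x) = 0"
    using assms herm_hproj unfolding tangent_space_def perp_line by (auto simp: perp_line)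
  also have "blinfun_apply t (v \<cdot> (\<langle>v, x\<rangle> /\<^sub>R re \<langle>v, v\<rangle>)) = blinfun_apply t v \<cdot> (\<langle>v, x\<rangle> /\<^sub>R re \<langle>v, v\<rangle>)"
    using assms(1) unfolding tangent_space_def by auto
  finally show "blinfun_apply t x = blinfun_apply (hor v (blinfun_apply t v)) x"
    by (simp add: hor_apply act_scaleR_right)
qed

text \<open>Cyclicity of the trace moves the computation from the ambient space to the scalars, where the map
  is left multiplication by \<open>c * \<langle>v, v\<rangle>\<close>; each basis vector contributes the real part of
  this scalar.\<close>

lemma trace_rank_one:
  assumes "\<And>x. blinfun_apply A x = v \<cdot> (c * \<langle>v, x\<rangle>)"
  shows "real_trace A = real DIM('k) * re c * re \<langle>v, v\<rangle>"
proof -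
  have lin: "linear (\<lambda>x. c * \<langle>v, x\<rangle>)"
    by (rule linearI) (simp_all add: herm_add_right herm_scaleR_right algebra_simps)
  have "real_trace A = (\<Sum>b\<in>Basis. \<Sum>e\<in>Basis. ((c * \<langle>v, b\<rangle>) \<bullet> e) * ((v \<cdot> e) \<bullet> b))"
  proof -
    have "(v \<cdot> k) \<bullet> b = (\<Sum>e\<in>Basis. (k \<bullet> e) * ((v \<cdot> e) \<bullet> b))" for k b
    proof -
      have "v \<cdot> k = v \<cdot> (\<Sum>e\<in>Basis. (k \<bullet> e) *\<^sub>R e)"
        by (simp add: euclidean_representation)
      then show ?thesis
        by (simp add: act.sum_right act_scaleR_right inner_sum_left)
    qed
    then show ?thesis
      unfolding real_trace_def assms by (intro sum.cong[OF refl])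
  qed
  also have "\<dots> = (\<Sum>e\<in>Basis. \<Sum>b\<in>Basis. ((c * \<langle>v, b\<rangle>) \<bullet> e) * ((v \<cdot> e) \<bullet> b))"
    by (rule sum.swap)
  also have "\<dots> = (\<Sum>e\<in>(Basis::'k set). re c * re \<langle>v, v\<rangle>)"
  proof (rule sum.cong[OF refl])
    fix e :: 'k assume e: "e \<in> Basis"
    have "c * \<langle>v, v \<cdot> e\<rangle> = (\<Sum>b\<in>Basis. ((v \<cdot> e) \<bullet> b) *\<^sub>R (c * \<langle>v, b\<rangle>))"
    proof -
      have "c * \<langle>v, v \<cdot> e\<rangle> = c * \<langle>v, \<Sum>b\<in>Basis. ((v \<cdot> e) \<bullet> b) *\<^sub>R b\<rangle>"
        by (simp add: euclidean_representation)
      then show ?thesis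
        by (simp only: linear_sum[OF lin] linear_scale[OF lin])
    qed
    then have "(\<Sum>b\<in>Basis. ((c * \<langle>v, b\<rangle>) \<bullet> e) * ((v \<cdot> e) \<bullet> b)) = (c * \<langle>v, v \<cdot> e\<rangle>) \<bullet> e"
      by (simp add: inner_sum_left mult.commute)
    also have "c * \<langle>v, v \<cdot> e\<rangle> = re \<langle>v, v\<rangle> *\<^sub>R (c * e)"
      by (subst herm_act_right, subst herm_self) (simp add: of_real_def)
    also have "(re \<langle>v, v\<rangle> *\<^sub>R (c * e)) \<bullet> e = re \<langle>v, v\<rangle> * re (conj e * (conj c * e))"
      by (simp add: inner_eq_re conj_mult conj_scaleR re_linear mult.assoc)
    also have "re (conj e * (conj c * e)) = re (conj c * (e * conj e))"
      by (subst re_mult_commute) (simp add: mult.assoc)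
    also have "\<dots> = re c"
      using e by (simp add: mult_conj_self)
    finally show "(\<Sum>b\<in>Basis. ((c * \<langle>v, b\<rangle>) \<bullet> e) * ((v \<cdot> e) \<bullet> b)) = re c * re \<langle>v, v\<rangle>"
      by simp
  qed
  finally show ?thesis
    by simp
qed

lemma adj_hor: "blinfun_apply (adj (hor v w)) y = (v \<cdot> \<langle>w, y\<rangle>) /\<^sub>R re \<langle>v, v\<rangle>"
proof -
  define s where "s = outer w v /\<^sub>R re \<langle>v, v\<rangle>"
  have s: "blinfun_apply s y = (v \<cdot> \<langle>w, y\<rangle>) /\<^sub>R re \<langle>v, v\<rangle>" for y
    by (simp add: s_def outer_apply blinfun.scaleR_left)
  have adjoint: "\<langle>blinfun_apply (hor v w) x, y\<rangle> = \<langle>x, blinfun_apply s y\<rangle>" for x y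
    by (simp add: hor_apply s herm_scaleR_left herm_scaleR_right herm_act_left herm_act_right
        herm_conj[symmetric])
  have "adj (hor v w) = s"
    unfolding adj_def
  proof (rule the_equality)
    show "\<forall>x y. \<langle>blinfun_apply (hor v w) x, y\<rangle> = \<langle>x, blinfun_apply s y\<rangle>"
      using adjoint by blast
    fix s' assume "\<forall>x y. \<langle>blinfun_apply (hor v w) x, y\<rangle> = \<langle>x, blinfun_apply s' y\<rangle>"
    then have "\<langle>x, blinfun_apply s' y - blinfun_apply s y\<rangle> = 0" for x y
      using adjoint by (simp add: herm.diff_right)
    then show "s' = s"
      using herm_nondegenerate_right by (intro blinfun_eqI) (metis eq_iff_diff_eq_0)
  qed
  then show ?thesis
    by (simp add: s)
qed

lemma metric_eq:
  assumes "v \<in> nonnull" "t1 \<in> tangent_space (line v)" "t2 \<in> tangent_space (line v)"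
  shows "metric \<epsilon> t1 t2 = \<epsilon> * (re \<langle>blinfun_apply t1 v, blinfun_apply t2 v\<rangle> / re \<langle>v, v\<rangle>)"
proof -
  define u where "u = blinfun_apply t1 v"
  define w where "w = blinfun_apply t2 v"
  define g where "g = re \<langle>v, v\<rangle>"
  have g: "g \<noteq> 0"
    using assms(1) by (simp add: g_def nonnull_iff)
  have t: "t1 = hor v u" "t2 = hor v w"
    unfolding u_def w_def using tangent_eq_hor assms by auto
  have "blinfun_apply (adj t1 o\<^sub>L t2) x = v \<cdot> (((1 / g\<^sup>2) *\<^sub>R \<langle>u, w\<rangle>) * \<langle>v, x\<rangle>)" for x
    unfolding t
    by (simp add: adj_hor hor_apply herm_scaleR_right herm_act_right act_scaleR_right
        g_def[symmetric] power2_eq_square divide_inverse)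
  from trace_rank_one[OF this] show ?thesis
    unfolding metric_def u_def[symmetric] w_def[symmetric] g_def[symmetric] using g
    by (simp add: re_linear power2_eq_square)
qed

section \<open>Horizontal lifts of vector fields\<close>

lemma bounded_bilinear_re_herm: "bounded_bilinear (\<lambda>v w. re \<langle>v, w\<rangle>)"
  by (subst bilinear_conv_bounded_bilinear[symmetric])
    (auto simp: bilinear_def herm_add_left herm_add_right herm_scaleR_left herm_scaleR_right re_linear
      intro!: linearI)

lemma smooth_inverse_norm: "smooth_on nonnull (\<lambda>v. inverse (re \<langle>v, v\<rangle>))"
  by (rule smooth_on_inverse[OF open_nonnull smooth_on_bilinear[OF open_nonnull bounded_bilinear_re_herm]])
    (auto simp: nonnull_iff intro: smooth_on_linear open_nonnull bounded_linear_ident)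

lemma smooth_ident: "smooth_on nonnull (\<lambda>v. v)"
  by (rule smooth_on_linear[OF open_nonnull bounded_linear_ident])

lemma smooth_on_hor:
  assumes "smooth_on nonnull s"
  shows "smooth_on nonnull (\<lambda>v. hor v (s v))"
  unfolding hor_def
  by (rule smooth_on_bilinear[OF open_nonnull bounded_bilinear_scaleR smooth_inverse_norm
        smooth_on_bilinear[OF open_nonnull bounded_bilinear_outer smooth_ident assms]])

lemma smooth_on_hproj:
  assumes "smooth_on nonnull s"
  shows "smooth_on nonnull (\<lambda>v. hproj v (s v))"
  unfolding hproj_def
  by (rule smooth_on_diff[OF open_nonnull assms
        smooth_on_bilinear[OF open_nonnull bounded_bilinear_scaleR smooth_inverse_norm
        smooth_on_bilinear[OF open_nonnull act.bounded_bilinear_axioms smooth_ident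
        smooth_on_bilinear[OF open_nonnull herm.bounded_bilinear_axioms smooth_ident assms]]]])

text \<open>The functions that arise from vector fields by evaluation on the representative: the second
  condition says that the value is tangent to the quotient, the third that different
  representatives describe the same tangent vector.\<close>

definition horizontal :: "('v \<Rightarrow> 'v) \<Rightarrow> bool" where
  "horizontal s \<longleftrightarrow> smooth_on nonnull s \<and> (\<forall>v\<in>nonnull. \<langle>v, s v\<rangle> = 0) \<and>
     (\<forall>v\<in>nonnull. \<forall>k. k \<noteq> 0 \<longrightarrow> s (v \<cdot> k) = s v \<cdot> k)"

lemma horizontalD:
  assumes "horizontal s"
  shows "smooth_on nonnull s" "v \<in> nonnull \<Longrightarrow> \<langle>v, s v\<rangle> = 0"
    "v \<in> nonnull \<Longrightarrow> k \<noteq> 0 \<Longrightarrow> s (v \<cdot> k) = s v \<cdot> k"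
  using assms unfolding horizontal_def by blast+

lemma horizontal_diff: "horizontal s \<Longrightarrow> horizontal t \<Longrightarrow> horizontal (\<lambda>v. s v - t v)"
  unfolding horizontal_def
  by (auto intro: smooth_on_diff open_nonnull simp: herm.diff_right act.diff_left)

definition lift :: "('v set \<Rightarrow> 'v \<Rightarrow>\<^sub>L 'v) \<Rightarrow> 'v \<Rightarrow> 'v" where
  "lift T v = blinfun_apply (T (line v)) v"

lemma vector_field_tangent: "vector_field T \<Longrightarrow> v \<in> nonnull \<Longrightarrow> T (line v) \<in> tangent_space (line v)"
  unfolding vector_field_def using line_nonisotropic by blast

lemma horizontal_lift:
  assumes "vector_field T"
  shows "horizontal (lift T)"
  unfolding horizontal_def
proof (intro conjI ballI allI impI)
  show "smooth_on nonnull (lift T)"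
    unfolding lift_def[abs_def]
    using assms unfolding vector_field_def nonisotropic_lift
    by (intro smooth_on_bilinear[OF open_nonnull bounded_bilinear_blinfun_apply _ smooth_ident]) blast
  fix v assume v: "v \<in> nonnull"
  show "\<langle>v, lift T v\<rangle> = 0"
    unfolding lift_def by (rule tangent_horizontal[OF vector_field_tangent[OF assms v]])
  fix k :: 'k assume "k \<noteq> 0"
  then show "lift T (v \<cdot> k) = lift T v \<cdot> k"
    using vector_field_tangent[OF assms v] by (simp add: lift_def line_act tangent_space_def)
qed

lemma vector_field_lift_eq: "vector_field T \<Longrightarrow> v \<in> nonnull \<Longrightarrow> T (line v) = hor v (lift T v)"
  unfolding lift_def using tangent_eq_hor vector_field_tangent by blast

lemma vector_field_eqI:
  assumes "vector_field S" "vector_field T" "\<And>v. v \<in> nonnull \<Longrightarrow> lift S v = lift T v"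
  shows "S = T"
proof
  fix L
  show "S L = T L"
  proof (cases "L \<in> nonisotropic_points")
    case True
    then obtain v where v: "v \<in> nonnull" "L = line v"
      by (rule nonisotropicE)
    then show ?thesis
      using vector_field_lift_eq[OF assms(1) v(1)] vector_field_lift_eq[OF assms(2) v(1)] assms(3)
      by simp
  next
    case False
    then show ?thesis
      using assms(1,2) by (simp add: vector_field_def)
  qed
qed

definition rep :: "'v set \<Rightarrow> 'v" where
  "rep L = (SOME v. L = line v)"

lemma rep_line:
  assumes "v \<in> nonnull"
  obtains k where "k \<noteq> 0" "rep (line v) = v \<cdot> k"
proof -
  have "line v = line (rep (line v))"
    unfolding rep_def by (rule someI[of "\<lambda>w. line v = line w" v]) simp
  then show ?thesis
    using line_eqE[of "rep (line v)" v] nonnull_nonzero[OF assms] that by metis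
qed

text \<open>Inverse to \<^term>\<open>lift\<close> on horizontal functions; equivariance makes the choice of the
  representative irrelevant.\<close>

definition descend :: "('v \<Rightarrow> 'v) \<Rightarrow> 'v set \<Rightarrow> 'v \<Rightarrow>\<^sub>L 'v" where
  "descend s L = (if L \<in> nonisotropic_points then hor (rep L) (s (rep L)) else 0)"

lemma hor_act:
  assumes "k \<noteq> 0"
  shows "hor (v \<cdot> k) (w \<cdot> k) = hor v w"
proof (rule blinfun_eqI)
  fix x
  have "w \<cdot> (k * (conj k * \<langle>v, x\<rangle>)) = (norm k)\<^sup>2 *\<^sub>R (w \<cdot> \<langle>v, x\<rangle>)"
    unfolding mult.assoc[symmetric, of k] mult_conj_self
    by (simp add: scaleR_conv_of_real[symmetric] act_scaleR_right del: of_real_power)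
  then show "blinfun_apply (hor (v \<cdot> k) (w \<cdot> k)) x = blinfun_apply (hor v w) x"
    using assms unfolding hor_apply re_herm_self_act by (simp add: herm_act_left act_mult[symmetric])
qed

lemma descend_line:
  assumes "horizontal s" "v \<in> nonnull"
  shows "descend s (line v) = hor v (s v)"
proof -
  obtain k where "k \<noteq> 0" "rep (line v) = v \<cdot> k"
    using rep_line[OF assms(2)] by blast
  then show ?thesis
    using assms by (simp add: descend_def line_nonisotropic horizontalD hor_act)
qed

lemma lift_descend: "horizontal s \<Longrightarrow> v \<in> nonnull \<Longrightarrow> lift (descend s) v = s v"
  by (simp add: lift_def descend_line hor_self)

lemma vector_field_descend:
  assumes "horizontal s"
  shows "vector_field (descend s)"
  unfolding vector_field_def nonisotropic_lift
proof (intro conjI ballI allI impI)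
  fix L assume "L \<in> nonisotropic_points"
  then obtain v where "v \<in> nonnull" "L = line v"
    by (rule nonisotropicE)
  then show "descend s L \<in> tangent_space L"
    using assms by (simp add: descend_line hor_tangent horizontalD)
next
  show "smooth_on nonnull (\<lambda>v. descend s (line v))"
    by (rule smooth_on_cong[OF open_nonnull smooth_on_hor[OF horizontalD(1)[OF assms]]])
      (simp add: descend_line assms)
qed (simp add: descend_def)

section \<open>Derivations\<close>

text \<open>The curves through different representatives of one point differ by a scalar factor and project
  to the same curve, so the derivation is an ordinary directional derivative of the lifted function.\<close>

lemma lie_derivative_line:
  assumes "v \<in> nonnull" "vector_field T"
    and F: "((\<lambda>v. f (line v)) has_derivative F') (at v)"
  shows "lie_derivative T f (line v) = F' (lift T v)"
proof -
  define t where "t = T (line v)"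
  have t: "t \<in> tangent_space (line v)"
    unfolding t_def by (rule vector_field_tangent[OF assms(2,1)])
  have "((\<lambda>e::real. f (line (v + e *\<^sub>R blinfun_apply t v))) has_real_derivative F' (blinfun_apply t v)) (at 0)"
    unfolding has_real_derivative_iff_has_vector_derivative
    using curve_has_derivative[of "\<lambda>v. f (line v)" F' v 0] F by simp
  moreover have "f (line (q + e *\<^sub>R blinfun_apply t q)) = f (line (v + e *\<^sub>R blinfun_apply t v))"
    if q: "q \<in> line v - {0}" for q and e :: real
  proof -
    obtain k where k: "q = v \<cdot> k"
      using q unfolding line_def by auto
    then have "k \<noteq> 0"
      using q by (auto simp: act.zero_right)
    have "q + e *\<^sub>R blinfun_apply t q = (v + e *\<^sub>R blinfun_apply t v) \<cdot> k"
      using t by (simp add: k tangent_space_def act_add_left act_scaleR_left)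
    then show ?thesis
      using line_act[OF \<open>k \<noteq> 0\<close>] by simp
  qed
  ultimately have *: "((\<lambda>e::real. f (line (q + e *\<^sub>R blinfun_apply t q))) has_real_derivative
      F' (blinfun_apply t v)) (at 0)" if "q \<in> line v - {0}" for q
    using that by simp
  have "v \<in> line v - {0}"
    using mem_line nonnull_nonzero[OF assms(1)] by blast
  then have "derivation (line v) t f = F' (blinfun_apply t v)"
    unfolding derivation_def using * DERIV_unique by (intro the_equality) blast+
  then show ?thesis
    by (simp add: lie_derivative_def lift_def t_def)
qed

text \<open>Along the vertical curve \<open>e \<mapsto> v \<cdot> (1 + e *\<^sub>R k)\<close> the transformation law under scalars determines
  the function, and hence its derivative.\<close>

lemma vertical_derivative:
  assumes F: "(F has_derivative F') (at v)" and L: "linear L"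
    and eq: "\<And>l. l \<noteq> 0 \<Longrightarrow> F (v \<cdot> l) = F v + L (l - 1)"
  shows "F' (v \<cdot> k) = L k"
proof -
  have "((\<lambda>e. F (v + e *\<^sub>R (v \<cdot> k))) has_vector_derivative F' (v \<cdot> k)) (at 0)"
    using curve_has_derivative[of F F' v 0] F by simp
  moreover have "((\<lambda>e. F (v + e *\<^sub>R (v \<cdot> k))) has_vector_derivative L k) (at 0)"
  proof (rule has_vector_derivative_transform_within_open)
    show "((\<lambda>e. F v + e *\<^sub>R L k) has_vector_derivative L k) (at 0)"
      by (auto intro!: derivative_eq_intros)
    show "open {e::real. 1 + e *\<^sub>R k \<noteq> 0}"
      by (intro open_Collect_neq continuous_intros)
    fix e assume "e \<in> {e::real. 1 + e *\<^sub>R k \<noteq> 0}"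
    moreover have "v + e *\<^sub>R (v \<cdot> k) = v \<cdot> (1 + e *\<^sub>R k)"
      by (simp add: act_add_right act_one act_scaleR_right)
    ultimately show "F v + e *\<^sub>R L k = F (v + e *\<^sub>R (v \<cdot> k))"
      using eq[of "1 + e *\<^sub>R k"] by (simp add: linear_scale[OF L])
  qed simp
  ultimately show ?thesis
    by (rule vector_derivative_unique_at)
qed

lemma vertical_derivative_invariant:
  assumes "(F has_derivative F') (at v)" "\<And>l. l \<noteq> 0 \<Longrightarrow> F (v \<cdot> l) = F v"
  shows "F' (v \<cdot> k) = 0"
  using vertical_derivative[OF assms(1), of "\<lambda>_. 0" k] assms(2) by (simp add: linear_zero)

lemma vertical_derivative_equivariant:
  assumes "(s has_derivative s') (at v)" "horizontal s" "v \<in> nonnull"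
  shows "s' (v \<cdot> k) = s v \<cdot> k"
proof (rule vertical_derivative[OF assms(1)])
  show "linear (\<lambda>k. s v \<cdot> k)"
    by (rule bounded_linear.linear[OF act.bounded_linear_right])
qed (use assms(2,3) in \<open>simp add: horizontalD act.diff_right act_one\<close>)

text \<open>Differentiating \<open>\<langle>v, s v\<rangle> = 0\<close>. This identity measures how the horizontal spaces turn
  and is the source of every curvature term.\<close>

lemma horizontal_derivative:
  assumes "(s has_derivative s') (at v)" "horizontal s" "v \<in> nonnull"
  shows "\<langle>v, s' h\<rangle> = - \<langle>h, s v\<rangle>"
proof -
  have "((\<lambda>v. \<langle>v, s v\<rangle>) has_derivative (\<lambda>h. \<langle>v, s' h\<rangle> + \<langle>h, s v\<rangle>)) (at v)"
    by (rule herm.FDERIV[OF has_derivative_ident assms(1)])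
  moreover have "((\<lambda>v. \<langle>v, s v\<rangle>) has_derivative (\<lambda>h. 0)) (at v)"
    by (rule has_derivative_transform_within_open[OF has_derivative_const[of 0] open_nonnull assms(3)])
      (simp add: horizontalD assms(2))
  ultimately have "(\<lambda>h. \<langle>v, s' h\<rangle> + \<langle>h, s v\<rangle>) = (\<lambda>h. 0)"
    by (rule has_derivative_unique)
  then show ?thesis
    by (simp add: fun_eq_iff add_eq_0_iff)
qed

lemma has_derivative_hproj:
  assumes w: "(w has_derivative w') (at v)" and v: "v \<in> nonnull"
  shows "((\<lambda>x. hproj x (w x)) has_derivative
    (\<lambda>h. w' h - (v \<cdot> (\<langle>v, w' h\<rangle> + \<langle>h, w v\<rangle>) + h \<cdot> \<langle>v, w v\<rangle>) /\<^sub>R re \<langle>v, v\<rangle>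
      + (2 * re \<langle>v, h\<rangle> / (re \<langle>v, v\<rangle>)\<^sup>2) *\<^sub>R (v \<cdot> \<langle>v, w v\<rangle>))) (at v)"
proof -
  interpret re_herm: bounded_bilinear "\<lambda>v w. re \<langle>v, w\<rangle>"
    by (rule bounded_bilinear_re_herm)
  have g: "re \<langle>v, v\<rangle> \<noteq> 0"
    using v by (simp add: nonnull_iff)
  have 1: "((\<lambda>x. x \<cdot> \<langle>x, w x\<rangle>) has_derivative
      (\<lambda>h. v \<cdot> (\<langle>v, w' h\<rangle> + \<langle>h, w v\<rangle>) + h \<cdot> \<langle>v, w v\<rangle>)) (at v)"
    by (intro act.FDERIV herm.FDERIV has_derivative_ident w)
  have 2: "((\<lambda>x. inverse (re \<langle>x, x\<rangle>)) has_derivative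
      (\<lambda>h. - (inverse (re \<langle>v, v\<rangle>) * (re \<langle>v, h\<rangle> + re \<langle>h, v\<rangle>) * inverse (re \<langle>v, v\<rangle>)))) (at v)"
    by (intro Deriv.has_derivative_inverse[of "\<lambda>x. re \<langle>x, x\<rangle>" v, OF g] re_herm.FDERIV has_derivative_ident)
  show ?thesis
    unfolding hproj_def
  proof (rule has_derivative_eq_rhs[OF has_derivative_diff[OF w has_derivative_scaleR[OF 2 1]]], rule ext)
    fix h
    let ?m = "v \<cdot> (\<langle>v, w' h\<rangle> + \<langle>h, w v\<rangle>) + h \<cdot> \<langle>v, w v\<rangle>" and ?c = "inverse (re \<langle>v, v\<rangle>)"
    have "- (?c * (re \<langle>v, h\<rangle> + re \<langle>h, v\<rangle>) * ?c) = - (2 * re \<langle>v, h\<rangle> / (re \<langle>v, v\<rangle>)\<^sup>2)"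
      unfolding re_herm_commute[of h v] by (simp add: power2_eq_square divide_inverse)
    then show "w' h - (?c *\<^sub>R ?m + - (?c * (re \<langle>v, h\<rangle> + re \<langle>h, v\<rangle>) * ?c) *\<^sub>R (v \<cdot> \<langle>v, w v\<rangle>))
      = w' h - ?m /\<^sub>R re \<langle>v, v\<rangle> + (2 * re \<langle>v, h\<rangle> / (re \<langle>v, v\<rangle>)\<^sup>2) *\<^sub>R (v \<cdot> \<langle>v, w v\<rangle>)"
      by simp
  qed
qed

lemma along_hproj:
  assumes "(w has_derivative w') (at v)" "v \<in> nonnull" "\<langle>v, t v\<rangle> = 0"
  shows "along t (\<lambda>x. hproj x (w x)) v
    = w' (t v) - (v \<cdot> (\<langle>v, w' (t v)\<rangle> + \<langle>t v, w v\<rangle>) + t v \<cdot> \<langle>v, w v\<rangle>) /\<^sub>R re \<langle>v, v\<rangle>"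
  using along_eq[OF has_derivative_hproj[OF assms(1,2)], of t] assms(3) by (simp add: re_linear)

section \<open>The horizontal connection\<close>

text \<open>The covariant derivative on lifts: differentiate in the flat ambient space and discard the
  component along the line.\<close>

definition cov :: "('v \<Rightarrow> 'v) \<Rightarrow> ('v \<Rightarrow> 'v) \<Rightarrow> 'v \<Rightarrow> 'v" where
  "cov t s v = hproj v (along t s v)"

lemma along_equivariant:
  assumes "horizontal t" "horizontal s" "v \<in> nonnull" "k \<noteq> 0"
  shows "along t s (v \<cdot> k) = along t s v \<cdot> k"
proof -
  define s' where "s' x = frechet_derivative s (at x)" for x
  have s': "(s has_derivative s' x) (at x)" if "x \<in> nonnull" for x
    unfolding s'_def by (rule smooth_on_has_derivative[OF horizontalD(1)[OF assms(2)] that])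
  have lin: "bounded_linear (\<lambda>x. x \<cdot> k)"
    by (rule act.bounded_linear_left)
  have "((\<lambda>x. s (x \<cdot> k)) has_derivative (\<lambda>h. s' (v \<cdot> k) (h \<cdot> k))) (at v)"
    by (rule has_derivative_compose[OF bounded_linear_imp_has_derivative[OF lin] s'])
      (rule nonnull_act[OF assms(3,4)])
  moreover have "((\<lambda>x. s (x \<cdot> k)) has_derivative (\<lambda>h. s' v h \<cdot> k)) (at v)"
    by (rule has_derivative_transform_within_open[OF bounded_linear.has_derivative[OF lin s'[OF assms(3)]]
          open_nonnull assms(3)]) (simp add: horizontalD assms)
  ultimately have "(\<lambda>h. s' (v \<cdot> k) (h \<cdot> k)) = (\<lambda>h. s' v h \<cdot> k)"
    by (rule has_derivative_unique)
  then show ?thesis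
    using assms by (simp add: along_def s'_def[symmetric] horizontalD fun_eq_iff)
qed

lemma horizontal_cov:
  assumes "horizontal t" "horizontal s"
  shows "horizontal (cov t s)"
  unfolding horizontal_def
proof (intro conjI ballI allI impI)
  show "smooth_on nonnull (cov t s)"
    unfolding cov_def[abs_def]
    by (intro smooth_on_hproj smooth_on_along open_nonnull horizontalD assms)
  show "\<langle>v, cov t s v\<rangle> = 0" if "v \<in> nonnull" for v
    unfolding cov_def by (rule herm_hproj[OF that])
  show "cov t s (v \<cdot> k) = cov t s v \<cdot> k" if "v \<in> nonnull" "k \<noteq> 0" for v k
    unfolding cov_def using that by (simp add: along_equivariant assms hproj_equivariant)
qed

text \<open>A field through a prescribed tangent vector: extend it linearly and project.\<close>

lemma horizontal_extension:
  assumes "v \<in> nonnull" "\<langle>v, w\<rangle> = 0"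
  shows "\<exists>s. horizontal s \<and> s v = w"
proof -
  define s where "s x = hproj x ((w \<cdot> \<langle>v, x\<rangle>) /\<^sub>R re \<langle>v, v\<rangle>)" for x
  have "bounded_linear (\<lambda>x. (w \<cdot> \<langle>v, x\<rangle>) /\<^sub>R re \<langle>v, v\<rangle>)"
    by (rule bounded_linear_compose[OF bounded_linear_scaleR_right
          bounded_linear_compose[OF act.bounded_linear_right herm.bounded_linear_right]])
  then have "smooth_on nonnull s"
    unfolding s_def[abs_def] by (intro smooth_on_hproj smooth_on_linear open_nonnull)
  moreover have "s (x \<cdot> k) = s x \<cdot> k" if "k \<noteq> 0" for x k
    unfolding s_def herm_act_right
    using hproj_equivariant[OF that, of x "(w \<cdot> \<langle>v, x\<rangle>) /\<^sub>R re \<langle>v, v\<rangle>" k]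
    by (simp add: act_mult act_scaleR_left)
  moreover have "s v = w"
    using assms act_herm_self[of w v 1] by (simp add: s_def act_one nonnull_iff hproj_eq)
  ultimately show ?thesis
    unfolding horizontal_def using herm_hproj by (auto simp: s_def)
qed

section \<open>The Lie bracket\<close>

definition bracket :: "('v \<Rightarrow> 'v) \<Rightarrow> ('v \<Rightarrow> 'v) \<Rightarrow> 'v \<Rightarrow> 'v" where
  "bracket t s v = cov t s v - cov s t v"

lemma horizontal_bracket: "horizontal t \<Longrightarrow> horizontal s \<Longrightarrow> horizontal (bracket t s)"
  unfolding bracket_def[abs_def] by (intro horizontal_diff horizontal_cov)

lemma bracket_eq: "bracket t s v = hproj v (along t s v - along s t v)"
  by (simp add: bracket_def cov_def linear_diff[OF linear_hproj])

text \<open>The ambient commutator differs from its horizontal projection by a vertical vector, and lifted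
  functions are constant in vertical directions.\<close>

lemma lie_derivative_commutator:
  assumes T: "vector_field T" and S: "vector_field S" and f: "smooth_fun f" and v: "v \<in> nonnull"
  shows "lie_derivative (descend (bracket (lift T) (lift S))) f (line v) =
    lie_derivative T (lie_derivative S f) (line v) - lie_derivative S (lie_derivative T f) (line v)"
proof -
  define F where "F x = f (line x)" for x
  define F' where "F' = frechet_derivative F (at v)"
  have F: "smooth_on nonnull F"
    using f unfolding smooth_fun_def nonisotropic_lift F_def[abs_def] .
  have F': "(F has_derivative F') (at v)"
    unfolding F'_def by (rule smooth_on_has_derivative[OF F v])
  have lin: "linear F'"
    using F' by (rule has_derivative_linear)
  have first: "lie_derivative S f (line x) = along (lift S) F x"
    if "vector_field S" "x \<in> nonnull" for S x
    using lie_derivative_line[OF that(2,1)] smooth_on_has_derivative[OF F that(2)]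
    unfolding F_def[abs_def] along_def by blast
  have second: "lie_derivative T (lie_derivative S f) (line v) = along (lift T) (along (lift S) F) v"
    if T: "vector_field T" and S: "vector_field S" for S T
  proof -
    have "smooth_on nonnull (along (lift S) F)"
      by (intro smooth_on_along open_nonnull F horizontalD(1) horizontal_lift S)
    from smooth_on_has_derivative[OF this v]
    have *: "(along (lift S) F has_derivative frechet_derivative (along (lift S) F) (at v)) (at v)" .
    have "((\<lambda>x. lie_derivative S f (line x)) has_derivative
        frechet_derivative (along (lift S) F) (at v)) (at v)"
      by (rule has_derivative_transform_within_open[OF * open_nonnull v]) (simp add: first S)
    from lie_derivative_line[OF v T this] show ?thesis
      by (simp add: along_def)
  qed
  define u where "u = along (lift T) (lift S) v - along (lift S) (lift T) v"
  have H: "horizontal (lift T)" "horizontal (lift S)"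
    using horizontal_lift T S by auto
  have "lie_derivative T (lie_derivative S f) (line v) - lie_derivative S (lie_derivative T f) (line v) = F' u"
    unfolding u_def F'_def second[OF T S] second[OF S T]
    by (rule along_commutator[OF open_nonnull F horizontalD(1)[OF H(1)] horizontalD(1)[OF H(2)] v])
  also have "\<dots> = F' (hproj v u) + F' (v \<cdot> (\<langle>v, u\<rangle> /\<^sub>R re \<langle>v, v\<rangle>))"
    by (metis hproj_decomp linear_add[OF lin])
  also have "F' (v \<cdot> (\<langle>v, u\<rangle> /\<^sub>R re \<langle>v, v\<rangle>)) = 0"
    by (rule vertical_derivative_invariant[OF F']) (simp add: F_def line_act)
  finally show ?thesis
    using lie_derivative_line[OF v vector_field_descend[OF horizontal_bracket[OF H]] F'[unfolded F_def[abs_def]]]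
    by (simp add: lift_descend horizontal_bracket H v bracket_eq u_def)
qed

text \<open>The components of the projection \<open>x \<mapsto> hproj x v\<close> of the fixed vector \<open>v\<close> are smooth
  functions of the point, and at \<open>v\<close> their derivative in a horizontal direction \<open>z\<close> is the
  component of \<^term>\<open>- z\<close>. Hence smooth functions separate tangent vectors.\<close>

lemma vector_field_determined:
  assumes Z: "vector_field Z" and Z': "vector_field Z'"
    and eq: "\<And>f v. smooth_fun f \<Longrightarrow> v \<in> nonnull \<Longrightarrow> lie_derivative Z f (line v) = lie_derivative Z' f (line v)"
  shows "Z = Z'"
proof (rule vector_field_eqI[OF Z Z'])
  fix v assume v: "v \<in> nonnull"
  show "lift Z v = lift Z' v"
  proof (rule euclidean_eqI)
    fix b :: 'v
    define f where "f L = hproj (rep L) v \<bullet> b" for L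
    have f: "f (line x) = hproj x v \<bullet> b" if x: "x \<in> nonnull" for x
    proof -
      obtain k where "k \<noteq> 0" "rep (line x) = x \<cdot> k"
        using rep_line[OF x] by blast
      then show ?thesis
        using hproj_equivariant[of k x v 1] by (simp add: f_def act_one)
    qed
    have inner: "bounded_linear (\<lambda>y. y \<bullet> b)"
      by (rule bounded_linear_inner_left)
    have "smooth_on nonnull (\<lambda>x. f (line x))"
      by (rule smooth_on_cong[OF open_nonnull smooth_on_compose_linear[OF open_nonnull inner
              smooth_on_hproj[OF smooth_on_const]]]) (simp add: f)
    then have smooth: "smooth_fun f"
      by (simp add: smooth_fun_def nonisotropic_lift)
    define D where "D h = 0 - (v \<cdot> (\<langle>v, 0\<rangle> + \<langle>h, v\<rangle>) + h \<cdot> \<langle>v, v\<rangle>) /\<^sub>R re \<langle>v, v\<rangle>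
      + (2 * re \<langle>v, h\<rangle> / (re \<langle>v, v\<rangle>)\<^sup>2) *\<^sub>R (v \<cdot> \<langle>v, v\<rangle>)" for h
    have "((\<lambda>x. hproj x v) has_derivative D) (at v)"
      unfolding D_def[abs_def] by (rule has_derivative_hproj[OF has_derivative_const v])
    then have deriv: "((\<lambda>x. f (line x)) has_derivative (\<lambda>h. D h \<bullet> b)) (at v)"
      by (intro has_derivative_transform_within_open[OF bounded_linear.has_derivative[OF inner] open_nonnull v])
        (simp_all add: f)
    have "D z = - z" if "\<langle>v, z\<rangle> = 0" for z
      using that v herm_zero_commute[of v z] act_herm_self[of z v 1]
      by (simp add: D_def re_linear herm.zero_right act.zero_right nonnull_iff act_one)
    moreover have "\<langle>v, lift Z v\<rangle> = 0" "\<langle>v, lift Z' v\<rangle> = 0"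
      using horizontalD(2)[OF horizontal_lift v] Z Z' by auto
    ultimately show "lift Z v \<bullet> b = lift Z' v \<bullet> b"
      using eq[OF smooth v] lie_derivative_line[OF v Z deriv] lie_derivative_line[OF v Z' deriv] by simp
  qed
qed

lemma lie_bracket_eq:
  assumes "vector_field T" "vector_field S"
  shows "lie_bracket T S = descend (bracket (lift T) (lift S))"
  unfolding lie_bracket_def
proof (rule the_equality)
  have H: "horizontal (bracket (lift T) (lift S))"
    using assms horizontal_bracket horizontal_lift by blast
  then show Z: "vector_field (descend (bracket (lift T) (lift S))) \<and>
      (\<forall>f. smooth_fun f \<longrightarrow> (\<forall>L\<in>nonisotropic_points.
         lie_derivative (descend (bracket (lift T) (lift S))) f L =
           lie_derivative T (lie_derivative S f) L - lie_derivative S (lie_derivative T f) L))"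
    using lie_derivative_commutator[OF assms] vector_field_descend by (metis nonisotropicE)
  fix Z' assume "vector_field Z' \<and> (\<forall>f. smooth_fun f \<longrightarrow> (\<forall>L\<in>nonisotropic_points.
         lie_derivative Z' f L =
           lie_derivative T (lie_derivative S f) L - lie_derivative S (lie_derivative T f) L))"
  then show "Z' = descend (bracket (lift T) (lift S))"
    using Z line_nonisotropic by (intro vector_field_determined) simp_all
qed

end

section \<open>Planes and singular symmetric matrices\<close>

text \<open>The ambient space may be infinite-dimensional, so the vectors are counted against a basis of \<open>W\<close>.\<close>

lemma subspace_dim_two:
  assumes "subspace W" "dim W = 2" "a \<in> W" "b \<in> W" "a \<noteq> b" "independent {a, b}"
  shows "W \<subseteq> span {a, b}"
proof
  fix x assume "x \<in> W"
  obtain B where B: "independent B" "W \<subseteq> span B" "card B = 2"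
    using basis_exists[of W] assms(2) by metis
  have "finite B"
    using B(3) by (metis card.infinite zero_neq_numeral)
  show "x \<in> span {a, b}"
  proof (rule ccontr)
    assume x: "x \<notin> span {a, b}"
    then have "independent {x, a, b}"
      using assms(6) by (rule independent_insertI)
    moreover have "{x, a, b} \<subseteq> span B"
      using B(2) assms(3,4) \<open>x \<in> W\<close> by blast
    ultimately have "card {x, a, b} \<le> 2"
      using independent_span_bound[OF \<open>finite B\<close>] B(3) by metis
    moreover have "x \<noteq> a" "x \<noteq> b"
      using x by (auto intro: span_base)
    ultimately show False
      using assms(5) by simp
  qed
qed

lemma singular_symmetric_kernel:
  fixes \<sigma> \<tau> \<rho> :: real
  assumes "\<sigma> * \<tau> = \<rho>\<^sup>2"
  obtains x y where "(x, y) \<noteq> (0, 0)" "x * \<sigma> + y * \<rho> = 0" "x * \<rho> + y * \<tau> = 0"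
proof (cases "\<sigma> = 0 \<and> \<rho> = 0")
  case True
  then show ?thesis
    using that[of 1 0] by simp
next
  case False
  then show ?thesis
    using that[of \<rho> "- \<sigma>"] assms by (auto simp: power2_eq_square)
qed

context hermitian_space
begin

section \<open>The Levi-Civita connection\<close>

lemma levi_civita_closed:
  assumes "levi_civita \<epsilon> nabla" "vector_field T" "vector_field S"
  shows "vector_field (nabla T S)"
proof -
  have "affine_connection nabla"
    using assms(1) unfolding levi_civita_def by (elim conjE)
  then have "\<forall>T S. vector_field T \<and> vector_field S \<longrightarrow> vector_field (nabla T S)"
    unfolding affine_connection_def by (elim conjE)
  then show ?thesis
    using assms(2,3) by simp
qed

lemma levi_civita_torsion_free:
  assumes "levi_civita \<epsilon> nabla" "vector_field T" "vector_field S"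
  shows "lie_bracket T S = (\<lambda>L. nabla T S L - nabla S T L)"
proof -
  have "\<forall>T S. vector_field T \<and> vector_field S \<longrightarrow> lie_bracket T S = (\<lambda>L. nabla T S L - nabla S T L)"
    using assms(1) unfolding levi_civita_def by (elim conjE)
  then show ?thesis
    using assms(2,3) by simp
qed

lemma levi_civita_metric:
  assumes "levi_civita \<epsilon> nabla" "vector_field T" "vector_field S" "vector_field S'" "v \<in> nonnull"
  shows "lie_derivative T (\<lambda>L. metric \<epsilon> (S L) (S' L)) (line v) =
    metric \<epsilon> (nabla T S (line v)) (S' (line v)) + metric \<epsilon> (S (line v)) (nabla T S' (line v))"
proof -
  have "\<forall>T S S'. vector_field T \<and> vector_field S \<and> vector_field S' \<longrightarrow>
      (\<forall>L \<in> nonisotropic_points. lie_derivative T (\<lambda>L. metric \<epsilon> (S L) (S' L)) L =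
        metric \<epsilon> (nabla T S L) (S' L) + metric \<epsilon> (S L) (nabla T S' L))"
    using assms(1) unfolding levi_civita_def by (elim conjE)
  then show ?thesis
    using assms(2-5) by (simp add: line_nonisotropic)
qed

text \<open>The norm of the representative is stationary in horizontal directions, so only the two fields
  contribute, and pairing with a horizontal vector does not see the discarded vertical component.\<close>

lemma lie_derivative_metric:
  assumes T: "vector_field T" and S: "vector_field S" and S': "vector_field S'" and v: "v \<in> nonnull"
  shows "lie_derivative T (\<lambda>L. metric \<epsilon> (S L) (S' L)) (line v) =
    \<epsilon> * (re \<langle>cov (lift T) (lift S) v, lift S' v\<rangle> / re \<langle>v, v\<rangle>)
      + \<epsilon> * (re \<langle>lift S v, cov (lift T) (lift S') v\<rangle> / re \<langle>v, v\<rangle>)"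
proof -
  interpret re_herm: bounded_bilinear "\<lambda>v w. re \<langle>v, w\<rangle>"
    by (rule bounded_bilinear_re_herm)
  have g: "re \<langle>v, v\<rangle> \<noteq> 0"
    using v by (simp add: nonnull_iff)
  have H: "horizontal (lift T)" "horizontal (lift S)" "horizontal (lift S')"
    using assms horizontal_lift by auto
  define s s' where "s = frechet_derivative (lift S) (at v)" and "s' = frechet_derivative (lift S') (at v)"
  have s: "(lift S has_derivative s) (at v)" and s': "(lift S' has_derivative s') (at v)"
    unfolding s_def s'_def
    using smooth_on_has_derivative[OF horizontalD(1)[OF H(2)] v]
      smooth_on_has_derivative[OF horizontalD(1)[OF H(3)] v] by auto
  define D where "D h = \<epsilon> * (re \<langle>lift S v, lift S' v\<rangle> *
      - (inverse (re \<langle>v, v\<rangle>) * (re \<langle>v, h\<rangle> + re \<langle>h, v\<rangle>) * inverse (re \<langle>v, v\<rangle>))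
      + (re \<langle>lift S v, s' h\<rangle> + re \<langle>s h, lift S' v\<rangle>) * inverse (re \<langle>v, v\<rangle>))" for h
  have "((\<lambda>x. \<epsilon> * (re \<langle>lift S x, lift S' x\<rangle> * inverse (re \<langle>x, x\<rangle>))) has_derivative D) (at v)"
    unfolding D_def[abs_def]
    by (intro has_derivative_mult_right has_derivative_mult re_herm.FDERIV has_derivative_ident s s'
        Deriv.has_derivative_inverse[of "\<lambda>x. re \<langle>x, x\<rangle>" v, OF g])
  note * = this
  have "\<epsilon> * (re \<langle>lift S x, lift S' x\<rangle> * inverse (re \<langle>x, x\<rangle>)) = metric \<epsilon> (S (line x)) (S' (line x))"
    if "x \<in> nonnull" for x
    using metric_eq[OF that] vector_field_tangent[OF _ that] S S'
    by (simp add: lift_def divide_inverse)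
  then have "((\<lambda>x. metric \<epsilon> (S (line x)) (S' (line x))) has_derivative D) (at v)"
    by (rule has_derivative_transform_within_open[OF * open_nonnull v])
  from lie_derivative_line[OF v T this]
  have "lie_derivative T (\<lambda>L. metric \<epsilon> (S L) (S' L)) (line v) = D (lift T v)" .
  also have "\<dots> = \<epsilon> * ((re \<langle>lift S v, s' (lift T v)\<rangle> + re \<langle>s (lift T v), lift S' v\<rangle>) / re \<langle>v, v\<rangle>)"
    using horizontalD(2)[OF H(1) v] herm_zero_commute[of v "lift T v"]
    by (simp add: D_def re_linear divide_inverse)
  also have "re \<langle>lift S v, s' (lift T v)\<rangle> = re \<langle>lift S v, cov (lift T) (lift S') v\<rangle>"
    unfolding cov_def along_eq[OF s'] using horizontalD(2)[OF H(2) v] by (simp add: herm_hproj_right)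
  also have "re \<langle>s (lift T v), lift S' v\<rangle> = re \<langle>cov (lift T) (lift S) v, lift S' v\<rangle>"
    unfolding cov_def along_eq[OF s] using horizontalD(2)[OF H(3) v] by (simp add: herm_hproj_left)
  finally show ?thesis
    by (simp add: add_divide_distrib distrib_left)
qed

text \<open>The difference between the given connection and \<^term>\<open>cov\<close> is symmetric in its two
  arguments, as both connections have the torsion-free property, and skew in the last two slots after
  pairing with a third field, as both preserve the metric. A function of three fields with these
  two symmetries vanishes.\<close>

lemma levi_civita_lift:
  assumes nabla: "levi_civita \<epsilon> nabla" and "\<epsilon> \<noteq> 0"
    and fields: "vector_field T" "vector_field S" and v: "v \<in> nonnull"
  shows "lift (nabla T S) v = cov (lift T) (lift S) v"
proof -
  note closed = levi_civita_closed[OF nabla]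
  define A where "A T S = lift (nabla T S) v - cov (lift T) (lift S) v" for T S
  have sym: "A T S = A S T" if "vector_field T" "vector_field S" for T S
  proof -
    have "lift (nabla T S) v - lift (nabla S T) v = lift (lie_bracket T S) v"
      unfolding levi_civita_torsion_free[OF nabla that] by (simp add: lift_def blinfun.diff_left)
    also have "\<dots> = bracket (lift T) (lift S) v"
      using that v by (simp add: lie_bracket_eq lift_descend horizontal_bracket horizontal_lift)
    finally show ?thesis
      by (simp add: A_def bracket_def algebra_simps)
  qed
  have skew: "re \<langle>A T S, lift S' v\<rangle> = - re \<langle>A T S', lift S v\<rangle>"
    if f: "vector_field T" "vector_field S" "vector_field S'" for T S S'
  proof -
    have m: "metric \<epsilon> (X (line v)) (Y (line v)) = \<epsilon> * (re \<langle>lift X v, lift Y v\<rangle> / re \<langle>v, v\<rangle>)"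
      if "vector_field X" "vector_field Y" for X Y
      using metric_eq[OF v] vector_field_tangent[OF _ v] that by (simp add: lift_def)
    have "re \<langle>cov (lift T) (lift S) v, lift S' v\<rangle> + re \<langle>lift S v, cov (lift T) (lift S') v\<rangle>
      = re \<langle>lift (nabla T S) v, lift S' v\<rangle> + re \<langle>lift S v, lift (nabla T S') v\<rangle>"
      using levi_civita_metric[OF nabla f v] \<open>\<epsilon> \<noteq> 0\<close> v
      unfolding lie_derivative_metric[OF f v] m[OF closed[OF f(1,2)] f(3)] m[OF f(2) closed[OF f(1,3)]]
      by (simp add: nonnull_iff distrib_left[symmetric] add_divide_distrib[symmetric])
    then show ?thesis
      unfolding A_def herm.diff_left re_linear re_herm_commute[of "lift S v"] by simp
  qed
  \<comment> \<open>Alternating the two symmetries permutes the three fields back to the start with a sign.\<close>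
  have zero: "re \<langle>A T S, lift U v\<rangle> = 0" if U: "vector_field U" for U
  proof -
    show ?thesis
      using skew[OF fields(2,1) U] skew[OF U fields(2,1)] skew[OF fields U]
      unfolding sym[OF fields(2,1)] sym[OF U fields(1)] sym[OF U fields(2)] by linarith
  qed
  have H: "horizontal (lift (nabla T S))" "horizontal (cov (lift T) (lift S))"
    using fields closed by (auto intro: horizontal_cov horizontal_lift)
  have perp: "\<langle>v, A T S\<rangle> = 0"
    using horizontalD(2)[OF H(1) v] horizontalD(2)[OF H(2) v] by (simp add: A_def herm.diff_right)
  have "A T S = 0"
  proof (rule re_herm_nondegenerate)
    fix w
    obtain u where "horizontal u" "u v = hproj v w"
      using horizontal_extension[OF v herm_hproj[OF v]] by blast
    then have "re \<langle>A T S, hproj v w\<rangle> = 0"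
      using zero[OF vector_field_descend] v lift_descend by metis
    then show "re \<langle>A T S, w\<rangle> = 0"
      by (simp add: herm_hproj_right perp)
  qed
  then show ?thesis
    by (simp add: A_def)
qed

section \<open>Curvature\<close>

text \<open>In terms of the tangent vectors \<open>t1\<close>, \<open>t2\<close>, \<open>s\<close> with lifts \<open>a\<close>, \<open>b\<close>,
  \<open>c\<close> at \<open>v\<close>, this is the lift of
  \<open>t2 t1\<^sup>* s - t1 t2\<^sup>* s + s t1\<^sup>* t2 - s t2\<^sup>* t1\<close>.\<close>

definition curv :: "'v \<Rightarrow> 'v \<Rightarrow> 'v \<Rightarrow> 'v \<Rightarrow> 'v" where
  "curv v a b c = (b \<cdot> \<langle>a, c\<rangle> - a \<cdot> \<langle>b, c\<rangle> + c \<cdot> (\<langle>a, b\<rangle> - \<langle>b, a\<rangle>)) /\<^sub>R re \<langle>v, v\<rangle>"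

text \<open>The inner projection is differentiated as well. The derivatives of its vertical terms stay
  vertical, except for the one that turns \<open>v\<close> into \<open>t2 v\<close>; its coefficient
  \<open>\<langle>v, along t1 s v\<rangle>\<close> is \<open>- \<langle>t1 v, s v\<rangle>\<close>.\<close>

lemma cov_cov:
  assumes H: "horizontal t1" "horizontal t2" "horizontal s" and v: "v \<in> nonnull"
  shows "cov t2 (cov t1 s) v = hproj v (along t2 (along t1 s) v + (t2 v \<cdot> \<langle>t1 v, s v\<rangle>) /\<^sub>R re \<langle>v, v\<rangle>)"
proof -
  have s: "(s has_derivative frechet_derivative s (at v)) (at v)"
    by (rule smooth_on_has_derivative[OF horizontalD(1)[OF H(3)] v])
  have "smooth_on nonnull (along t1 s)"
    by (intro smooth_on_along open_nonnull horizontalD(1) H)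
  then have D: "(along t1 s has_derivative frechet_derivative (along t1 s) (at v)) (at v)"
    using smooth_on_has_derivative v by blast
  have "\<langle>v, along t1 s v\<rangle> = - \<langle>t1 v, s v\<rangle>"
    unfolding along_def by (rule horizontal_derivative[OF s H(3) v])
  then have "along t2 (cov t1 s) v = along t2 (along t1 s) v + (t2 v \<cdot> \<langle>t1 v, s v\<rangle>) /\<^sub>R re \<langle>v, v\<rangle>
      - (v \<cdot> (\<langle>v, along t2 (along t1 s) v\<rangle> + \<langle>t2 v, along t1 s v\<rangle>)) /\<^sub>R re \<langle>v, v\<rangle>"
    using along_hproj[where t = t2, OF D v horizontalD(2)[OF H(2) v]]
    unfolding cov_def[abs_def] by (simp add: along_def[of t2] act.minus_right scaleR_add_right scaleR_diff_right)
  then show ?thesis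
    unfolding cov_def[of t2] by (simp add: linear_diff[OF linear_hproj] linear_scale[OF linear_hproj] hproj_act_self[OF v])
qed

text \<open>The second-order terms cancel up to the derivative of \<open>s\<close> along the ambient commutator of
  the fields. The Lie bracket compensates the horizontal part of that commutator; the vertical part
  \<open>v \<cdot> c\<close> contributes \<open>- (s v \<cdot> c)\<close> by equivariance of \<open>s\<close>, which is the
  last term of \<^term>\<open>curv\<close>.\<close>

lemma curvature_lift:
  assumes H: "horizontal t1" "horizontal t2" "horizontal s" and v: "v \<in> nonnull"
  shows "cov t2 (cov t1 s) v - cov t1 (cov t2 s) v + cov (bracket t1 t2) s v
    = curv v (t1 v) (t2 v) (s v)"
proof -
  define s' where "s' = frechet_derivative s (at v)"
  define u where "u = along t1 t2 v - along t2 t1 v"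
  define c where "c = (\<langle>t2 v, t1 v\<rangle> - \<langle>t1 v, t2 v\<rangle>) /\<^sub>R re \<langle>v, v\<rangle>"
  have der: "(t has_derivative frechet_derivative t (at v)) (at v)" if "horizontal t" for t
    by (rule smooth_on_has_derivative[OF horizontalD(1)[OF that] v])
  have s: "(s has_derivative s') (at v)"
    unfolding s'_def by (rule der[OF H(3)])
  have lin: "linear s'"
    using s by (rule has_derivative_linear)
  have vu: "\<langle>v, u\<rangle> = \<langle>t2 v, t1 v\<rangle> - \<langle>t1 v, t2 v\<rangle>"
    using horizontal_derivative[OF der[OF H(1)] H(1) v] horizontal_derivative[OF der[OF H(2)] H(2) v]
    by (simp add: u_def along_def herm.diff_right)
  have "bracket t1 t2 v = u - v \<cdot> c"
    unfolding bracket_eq u_def[symmetric] hproj_def[of v u] vu c_def act_scaleR_right ..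
  then have bracket: "along (bracket t1 t2) s v = s' u - s v \<cdot> c"
    using vertical_derivative_equivariant[OF s H(3) v, of c]
    by (simp add: along_eq[OF s] linear_diff[OF lin])
  have comm: "along t2 (along t1 s) v - along t1 (along t2 s) v = - s' u"
    using along_commutator[OF open_nonnull horizontalD(1)[OF H(3)] horizontalD(1)[OF H(2)] horizontalD(1)[OF H(1)] v]
      linear_neg[OF lin, of u]
    by (simp add: u_def s'_def)
  have "cov t2 (cov t1 s) v - cov t1 (cov t2 s) v + cov (bracket t1 t2) s v =
    hproj v ((along t2 (along t1 s) v + (t2 v \<cdot> \<langle>t1 v, s v\<rangle>) /\<^sub>R re \<langle>v, v\<rangle>)
      - (along t1 (along t2 s) v + (t1 v \<cdot> \<langle>t2 v, s v\<rangle>) /\<^sub>R re \<langle>v, v\<rangle>) + (s' u - s v \<cdot> c))"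
    unfolding cov_cov[OF H v] cov_cov[OF H(2,1,3) v] cov_def[of "bracket t1 t2"] bracket
    by (simp add: linear_diff[OF linear_hproj] linear_add[OF linear_hproj])
  also have "(along t2 (along t1 s) v + (t2 v \<cdot> \<langle>t1 v, s v\<rangle>) /\<^sub>R re \<langle>v, v\<rangle>)
      - (along t1 (along t2 s) v + (t1 v \<cdot> \<langle>t2 v, s v\<rangle>) /\<^sub>R re \<langle>v, v\<rangle>) + (s' u - s v \<cdot> c)
    = curv v (t1 v) (t2 v) (s v)"
    using comm
    by (simp add: curv_def c_def act_scaleR_right act.diff_right scaleR_add_right scaleR_diff_right algebra_simps)
  also have "hproj v (curv v (t1 v) (t2 v) (s v)) = curv v (t1 v) (t2 v) (s v)"
    using H v
    by (intro hproj_eq) (simp add: curv_def herm_scaleR_right herm_add_right herm.diff_right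
        herm_act_right horizontalD)
  finally show ?thesis .
qed

lemma hor_linear: "hor v (a - b + c) = hor v a - hor v b + hor v c"
  by (simp add: hor_def bounded_bilinear.add_right[OF bounded_bilinear_outer]
      bounded_bilinear.diff_right[OF bounded_bilinear_outer] scaleR_add_right scaleR_diff_right)

lemma curvature_field_line:
  assumes nabla: "levi_civita \<epsilon> nabla" and "\<epsilon> \<noteq> 0" and v: "v \<in> nonnull"
    and fields: "vector_field T1" "vector_field T2" "vector_field S"
  shows "curvature_field nabla T1 T2 S (line v) = hor v (curv v (lift T1 v) (lift T2 v) (lift S v))"
proof -
  note closed = levi_civita_closed[OF nabla]
  note lift = levi_civita_lift[OF nabla \<open>\<epsilon> \<noteq> 0\<close>]
  have H: "horizontal (lift T1)" "horizontal (lift T2)" "horizontal (lift S)"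
    using fields horizontal_lift by auto
  have iterate: "nabla T (nabla T' S) (line v) = hor v (cov (lift T) (cov (lift T') (lift S)) v)"
    if f: "vector_field T" "vector_field T'" for T T'
  proof -
    have "smooth_on nonnull (lift (nabla T' S))"
      using closed[OF f(2) fields(3)] horizontal_lift horizontalD(1) by blast
    then have "lift (nabla T' S) differentiable (at v)"
      using smooth_on_has_derivative[OF _ v] unfolding differentiable_def by blast
    then have "along (lift T) (lift (nabla T' S)) v = along (lift T) (cov (lift T') (lift S)) v"
      by (rule along_cong[OF _ open_nonnull v]) (rule lift[OF f(2) fields(3)])
    then have "cov (lift T) (lift (nabla T' S)) v = cov (lift T) (cov (lift T') (lift S)) v"
      by (simp add: cov_def)
    then show ?thesis
      using vector_field_lift_eq[OF closed[OF f(1) closed[OF f(2) fields(3)]] v]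
        lift[OF f(1) closed[OF f(2) fields(3)] v] by simp
  qed
  have Z: "vector_field (lie_bracket T1 T2)" "lift (lie_bracket T1 T2) v = bracket (lift T1) (lift T2) v"
    using H v by (simp_all add: lie_bracket_eq fields vector_field_descend lift_descend horizontal_bracket)
  have "nabla (lie_bracket T1 T2) S (line v) = hor v (cov (bracket (lift T1) (lift T2)) (lift S) v)"
    using vector_field_lift_eq[OF closed[OF Z(1) fields(3)] v] lift[OF Z(1) fields(3) v]
    by (simp add: cov_def along_def Z(2))
  then show ?thesis
    unfolding curvature_field_def iterate[OF fields(2,1)] iterate[OF fields(1,2)]
      curvature_lift[OF H v, symmetric] hor_linear by simp
qed

lemma curvature_line:
  assumes nabla: "levi_civita \<epsilon> nabla" and "\<epsilon> \<noteq> 0" and v: "v \<in> nonnull"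
    and perp: "\<langle>v, a\<rangle> = 0" "\<langle>v, b\<rangle> = 0" "\<langle>v, c\<rangle> = 0"
  shows "curvature nabla (line v) (hor v a) (hor v b) (hor v c) = hor v (curv v a b c)"
  unfolding curvature_def
proof (rule the_equality)
  have field: "curvature_field nabla T1 T2 S (line v) = hor v (curv v a b c)"
    if "vector_field T1" "vector_field T2" "vector_field S"
      and "T1 (line v) = hor v a" "T2 (line v) = hor v b" "S (line v) = hor v c" for T1 T2 S
    using curvature_field_line[OF nabla \<open>\<epsilon> \<noteq> 0\<close> v that(1-3)]
    unfolding lift_def that(4-6) hor_self[OF v] .
  then show "\<forall>T1 T2 S. vector_field T1 \<and> vector_field T2 \<and> vector_field S \<and>
      T1 (line v) = hor v a \<and> T2 (line v) = hor v b \<and> S (line v) = hor v c \<longrightarrow>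
      curvature_field nabla T1 T2 S (line v) = hor v (curv v a b c)"
    by blast
  have ext: "\<exists>T. vector_field T \<and> T (line v) = hor v x" if x: "\<langle>v, x\<rangle> = 0" for x
  proof -
    obtain s where "horizontal s" "s v = x"
      using horizontal_extension[OF v x] by blast
    then show ?thesis
      using vector_field_descend[of s] descend_line[of s v] v by auto
  qed
  obtain T1 T2 S where T: "vector_field T1" "vector_field T2" "vector_field S"
    "T1 (line v) = hor v a" "T2 (line v) = hor v b" "S (line v) = hor v c"
    using ext[OF perp(1)] ext[OF perp(2)] ext[OF perp(3)] by blast
  fix r
  assume "\<forall>T1 T2 S. vector_field T1 \<and> vector_field T2 \<and> vector_field S \<and>
      T1 (line v) = hor v a \<and> T2 (line v) = hor v b \<and> S (line v) = hor v c \<longrightarrow>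
      curvature_field nabla T1 T2 S (line v) = r"
  then show "r = hor v (curv v a b c)"
    using T field[OF T] by metis
qed

lemma metric_hor:
  assumes "v \<in> nonnull" "\<langle>v, a\<rangle> = 0" "\<langle>v, b\<rangle> = 0"
  shows "metric \<epsilon> (hor v a) (hor v b) = \<epsilon> * (re \<langle>a, b\<rangle> / re \<langle>v, v\<rangle>)"
  using metric_eq[OF assms(1) hor_tangent[OF assms(2)] hor_tangent[OF assms(3)]] assms(1)
  by (simp add: hor_self)

text \<open>The third summand of \<^term>\<open>curv\<close> and the second one combine to a coefficient
  \<open>k - 2 *\<^sub>R conj k\<close>, where \<open>k = \<langle>a, b\<rangle>\<close>,
  so the real part of \<open>k * k\<close> enters; rewriting it by \<open>re_square\<close> produces the square of
  the imaginary part of \<open>k\<close>, that is, a quarter of \<open>(norm (k - conj k))\<^sup>2\<close>.\<close>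

lemma re_herm_curv:
  assumes "\<langle>a, a\<rangle> = of_real \<sigma>" "\<langle>b, b\<rangle> = of_real \<tau>"
  shows "re \<langle>curv v a b a, b\<rangle> =
    (\<sigma> * \<tau> - (re \<langle>a, b\<rangle>)\<^sup>2 + 3 / 4 * (norm (\<langle>a, b\<rangle> - conj \<langle>a, b\<rangle>))\<^sup>2) / re \<langle>v, v\<rangle>"
proof -
  define k where "k = \<langle>a, b\<rangle>"
  have k: "\<langle>a, b\<rangle> = k" "\<langle>b, a\<rangle> = conj k"
    unfolding k_def by (auto simp: herm_conj[symmetric])
  have "b \<cdot> \<langle>a, a\<rangle> - a \<cdot> \<langle>b, a\<rangle> + a \<cdot> (\<langle>a, b\<rangle> - \<langle>b, a\<rangle>) = \<sigma> *\<^sub>R b + a \<cdot> (k - 2 *\<^sub>R conj k)"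
    by (simp add: assms k act_of_real act.diff_right act_scaleR_right scaleR_2[symmetric])
  then have "re \<langle>curv v a b a, b\<rangle> = (\<sigma> * \<tau> + re (conj k * k - 2 *\<^sub>R (k * k))) / re \<langle>v, v\<rangle>"
    unfolding curv_def
    by (simp add: herm_scaleR_left herm_add_left herm_act_left assms k re_linear conj_diff conj_scaleR
        conj_conj left_diff_distrib divide_inverse mult.commute)
  also have "re (conj k * k - 2 *\<^sub>R (k * k)) = 3 * (norm k)\<^sup>2 - 4 * (re k)\<^sup>2"
    by (simp add: conj_mult_self re_linear re_square)
  also have "\<sigma> * \<tau> + (3 * (norm k)\<^sup>2 - 4 * (re k)\<^sup>2) =
      \<sigma> * \<tau> - (re k)\<^sup>2 + 3 / 4 * (norm (k - conj k))\<^sup>2"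
    unfolding norm_minus_conj by (simp add: field_simps)
  finally show ?thesis
    unfolding k .
qed

text \<open>The lifts of \<open>t1\<close> and \<open>t2\<close> at \<open>p\<close> are the multiples of \<open>v1\<close> and
  \<open>v2\<close> by \<open>g = \<langle>p, p\<rangle>\<close>. Both the numerator and the denominator then carry the factor
  \<open>g\<^sup>2\<close>, so \<open>g\<close> cancels, while \<open>\<epsilon>\<close> occurs once above and
  twice below.\<close>

lemma sectional_curvature_eq:
  assumes sign: "\<epsilon> = 1 \<or> \<epsilon> = -1"
    and nabla: "levi_civita \<epsilon> nabla"
    and p: "\<langle>p, p\<rangle> \<noteq> 0"
    and W: "subspace W" "dim W = 2" "W \<subseteq> tangent_space (line p)"
    and W_nondegenerate: "\<forall>t\<in>W. (\<forall>s\<in>W. metric \<epsilon> t s = 0) \<longrightarrow> t = 0"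
    and t_in_W: "t1 \<in> W" "t2 \<in> W"
    and t_independent: "t1 \<noteq> t2" "independent {t1, t2}"
    and t1: "\<forall>x. blinfun_apply t1 x = v1 \<cdot> \<langle>p, x\<rangle>"
    and t2: "\<forall>x. blinfun_apply t2 x = v2 \<cdot> \<langle>p, x\<rangle>"
    and perp: "\<langle>p, v1\<rangle> = 0" "\<langle>p, v2\<rangle> = 0"
    and \<sigma>1: "\<langle>v1, v1\<rangle> = of_real \<sigma>1"
    and \<sigma>2: "\<langle>v2, v2\<rangle> = of_real \<sigma>2"
    and k: "k = \<langle>v1, v2\<rangle>"
  shows "sectional_curvature \<epsilon> nabla (line p) t1 t2 =
    \<epsilon> * (1 + 3 * (norm (k - conj k))\<^sup>2 / (4 * (\<sigma>1 * \<sigma>2 - (re k)\<^sup>2)))"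
proof -
  define g where "g = re \<langle>p, p\<rangle>"
  have pn: "p \<in> nonnull"
    using p by (simp add: nonnull_def)
  have g: "g \<noteq> 0"
    using pn by (simp add: nonnull_iff g_def)
  define a b where "a = g *\<^sub>R v1" and "b = g *\<^sub>R v2"
  have ab: "\<langle>p, a\<rangle> = 0" "\<langle>p, b\<rangle> = 0"
    using perp by (simp_all add: a_def b_def herm_scaleR_right)
  have t: "t1 = hor p a" "t2 = hor p b"
    using t1 t2 g by (auto intro!: blinfun_eqI simp: hor_apply a_def b_def act_scaleR_left g_def[symmetric])
  have forms: "\<langle>a, a\<rangle> = of_real (g\<^sup>2 * \<sigma>1)" "\<langle>b, b\<rangle> = of_real (g\<^sup>2 * \<sigma>2)" "\<langle>a, b\<rangle> = g\<^sup>2 *\<^sub>R k"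
    by (simp_all add: a_def b_def herm_scaleR_left herm_scaleR_right \<sigma>1 \<sigma>2 k power2_eq_square
        scaleR_conv_of_real mult.assoc)
  have metric: "metric \<epsilon> t1 t1 = \<epsilon> * (g * \<sigma>1)" "metric \<epsilon> t2 t2 = \<epsilon> * (g * \<sigma>2)"
    "metric \<epsilon> t1 t2 = \<epsilon> * (g * re k)" "metric \<epsilon> t2 t1 = \<epsilon> * (g * re k)"
    unfolding t metric_hor[OF pn ab(1,1)] metric_hor[OF pn ab(2,2)] metric_hor[OF pn ab(1,2)]
      metric_hor[OF pn ab(2,1)] re_herm_commute[of b] forms re_linear g_def[symmetric]
    using g by (simp_all add: power2_eq_square)
  \<comment> \<open>A singular Gram matrix would provide a nonzero vector of \<open>W\<close> orthogonal to \<open>W\<close>.\<close>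
  have nondeg: "\<sigma>1 * \<sigma>2 - (re k)\<^sup>2 \<noteq> 0"
  proof
    assume "\<sigma>1 * \<sigma>2 - (re k)\<^sup>2 = 0"
    then obtain x y where xy: "(x, y) \<noteq> (0, 0)" "x * \<sigma>1 + y * re k = 0" "x * re k + y * \<sigma>2 = 0"
      using singular_symmetric_kernel[of \<sigma>1 \<sigma>2 "re k"] by auto
    define t where "t = x *\<^sub>R t1 + y *\<^sub>R t2"
    have "t \<in> W"
      unfolding t_def using W(1) t_in_W by (intro subspace_add subspace_scale)
    have tang: "s \<in> tangent_space (line p)" if "s \<in> W" for s
      using that W(3) by blast
    have m: "metric \<epsilon> r s = \<epsilon> * (re \<langle>blinfun_apply r p, blinfun_apply s p\<rangle> / g)" if "r \<in> W" "s \<in> W" for r s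
      unfolding g_def by (rule metric_eq[OF pn tang[OF that(1)] tang[OF that(2)]])
    have lin: "metric \<epsilon> t s = x * metric \<epsilon> t1 s + y * metric \<epsilon> t2 s" if "s \<in> W" for s
      unfolding m[OF \<open>t \<in> W\<close> that] m[OF t_in_W(1) that] m[OF t_in_W(2) that]
      by (simp add: t_def blinfun.add_left blinfun.scaleR_left herm_add_left herm_scaleR_left re_linear
          distrib_left add_divide_distrib mult.left_commute)
    have "metric \<epsilon> t t1 = \<epsilon> * g * (x * \<sigma>1 + y * re k)" "metric \<epsilon> t t2 = \<epsilon> * g * (x * re k + y * \<sigma>2)"
      unfolding lin[OF t_in_W(1)] lin[OF t_in_W(2)] metric by (simp_all add: algebra_simps)
    then have zero: "metric \<epsilon> t t1 = 0" "metric \<epsilon> t t2 = 0"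
      by (simp_all add: xy)
    have "metric \<epsilon> t s = 0" if s: "s \<in> W" for s
    proof -
      have "s \<in> span {t1, t2}"
        using subspace_dim_two[OF W(1,2) t_in_W t_independent] s by blast
      then obtain \<alpha> \<beta> where "s = \<alpha> *\<^sub>R t1 + \<beta> *\<^sub>R t2"
        by (auto simp: span_insert span_singleton algebra_simps)
      then have "metric \<epsilon> t s = \<alpha> * metric \<epsilon> t t1 + \<beta> * metric \<epsilon> t t2"
        unfolding m[OF \<open>t \<in> W\<close> s] m[OF \<open>t \<in> W\<close> t_in_W(1)] m[OF \<open>t \<in> W\<close> t_in_W(2)]
        by (simp add: blinfun.add_left blinfun.scaleR_left herm_add_right herm_scaleR_right re_linear
            distrib_left add_divide_distrib mult.left_commute)
      then show ?thesis
        by (simp add: zero)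
    qed
    then have "t = 0"
      using W_nondegenerate \<open>t \<in> W\<close> by blast
    define c where "c z = (if z = t1 then x else y)" for z
    have "(\<Sum>z\<in>{t1, t2}. c z *\<^sub>R z) = 0"
      using t_independent(1) \<open>t = 0\<close> by (simp add: c_def t_def)
    then have "c t1 = 0" "c t2 = 0"
      using independentD[OF t_independent(2), of "{t1, t2}" c] by auto
    then have "x = 0 \<and> y = 0"
      using t_independent(1) by (simp add: c_def)
    then show False
      using xy(1) by simp
  qed
  have "curvature nabla (line p) t1 t2 t1 = hor p (curv p a b a)"
    unfolding t using sign by (intro curvature_line[OF nabla _ pn] ab) auto
  moreover have "\<langle>p, curv p a b a\<rangle> = 0"
    by (simp add: curv_def herm_scaleR_right herm_add_right herm.diff_right herm_act_right ab)
  ultimately have "metric \<epsilon> (curvature nabla (line p) t1 t2 t1) t2 = \<epsilon> * (re \<langle>curv p a b a, b\<rangle> / g)"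
    unfolding g_def using metric_hor[OF pn _ ab(2)] by (simp add: t(2))
  also have "\<dots> = \<epsilon> * g\<^sup>2 * (\<sigma>1 * \<sigma>2 - (re k)\<^sup>2 + 3 / 4 * (norm (k - conj k))\<^sup>2)"
  proof -
    have norm: "(norm (g\<^sup>2 *\<^sub>R k - conj (g\<^sup>2 *\<^sub>R k)))\<^sup>2 = (g\<^sup>2)\<^sup>2 * (norm (k - conj k))\<^sup>2"
      by (simp add: conj_scaleR scaleR_diff_right[symmetric] power_mult_distrib)
    have "re \<langle>curv p a b a, b\<rangle> = g ^ 3 * (\<sigma>1 * \<sigma>2 - (re k)\<^sup>2 + 3 / 4 * (norm (k - conj k))\<^sup>2)"
      unfolding re_herm_curv[OF forms(1,2)] forms(3) re_linear norm g_def[symmetric]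
      using g by (simp add: field_simps power2_eq_square power3_eq_cube)
    then show ?thesis
      using g by (simp add: power2_eq_square power3_eq_cube)
  qed
  finally have num: "metric \<epsilon> (curvature nabla (line p) t1 t2 t1) t2 =
    \<epsilon> * g\<^sup>2 * (\<sigma>1 * \<sigma>2 - (re k)\<^sup>2 + 3 / 4 * (norm (k - conj k))\<^sup>2)" .
  have den: "metric \<epsilon> t1 t1 * metric \<epsilon> t2 t2 - (metric \<epsilon> t1 t2)\<^sup>2 = g\<^sup>2 * (\<sigma>1 * \<sigma>2 - (re k)\<^sup>2)"
    unfolding metric using sign by (auto simp: power2_eq_square algebra_simps)
  have "\<epsilon> * g\<^sup>2 * (D + 3 / 4 * N) / (g\<^sup>2 * D) = \<epsilon> * (1 + 3 * N / (4 * D))" if "D \<noteq> 0" for D N :: real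
    using g that by (simp add: field_simps)
  then show ?thesis
    unfolding sectional_curvature_def num den using nondeg by blast
qed

end

theorem mainTheorem5:
  fixes act :: "'v::euclidean_space \<Rightarrow> 'k::rch_algebra \<Rightarrow> 'v"
    and herm :: "'v \<Rightarrow> 'v \<Rightarrow> 'k"
    and \<epsilon> :: real
    and nabla :: "('v set \<Rightarrow> 'v \<Rightarrow>\<^sub>L 'v) \<Rightarrow> ('v set \<Rightarrow> 'v \<Rightarrow>\<^sub>L 'v) \<Rightarrow> 'v set \<Rightarrow> 'v \<Rightarrow>\<^sub>L 'v"
    and p v1 v2 :: 'v
    and W :: "('v \<Rightarrow>\<^sub>L 'v) set"
    and t1 t2 :: "'v \<Rightarrow>\<^sub>L 'v"
    and \<sigma>1 \<sigma>2 :: real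
    and k :: 'k
  assumes V: "hermitian_space act herm"
    and sign: "\<epsilon> = 1 \<or> \<epsilon> = -1"
    and nabla: "hermitian_space.levi_civita act herm \<epsilon> nabla"
    and p: "p \<noteq> 0" "herm p p \<noteq> 0"
    and W: "subspace W" "dim W = 2"
      "W \<subseteq> hermitian_space.tangent_space act herm (hermitian_space.line act p)"
    and W_nondegenerate:
      "\<forall>t\<in>W. (\<forall>s\<in>W. hermitian_space.metric herm \<epsilon> t s = 0) \<longrightarrow> t = 0"
    and t_in_W: "t1 \<in> W" "t2 \<in> W"
    and t_independent: "t1 \<noteq> t2" "independent {t1, t2}"
    and t1: "\<forall>x. blinfun_apply t1 x = act v1 (herm p x)"
    and t2: "\<forall>x. blinfun_apply t2 x = act v2 (herm p x)"
    and v1: "v1 \<in> hermitian_space.perp herm (hermitian_space.line act p)"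
    and v2: "v2 \<in> hermitian_space.perp herm (hermitian_space.line act p)"
    and \<sigma>1: "herm v1 v1 = of_real \<sigma>1" "\<sigma>1 \<in> {-1, 0, 1}"
    and \<sigma>2: "herm v2 v2 = of_real \<sigma>2" "\<sigma>2 \<in> {-1, 0, 1}"
    and k: "k = herm v1 v2"
  shows "hermitian_space.sectional_curvature act herm \<epsilon> nabla (hermitian_space.line act p) t1 t2 =
           \<epsilon> * (1 + 3 * (norm (k - conj k))\<^sup>2 / (4 * (\<sigma>1 * \<sigma>2 - (re k)\<^sup>2)))"
proof -
  have perp: "herm p v1 = 0" "herm p v2 = 0"
    using v1 v2 hermitian_space.perp_line[OF V] by auto
  show ?thesis
    by (rule hermitian_space.sectional_curvature_eq[OF V sign nabla p(2) W W_nondegenerate t_in_W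
          t_independent t1 t2 perp \<sigma>1(1) \<sigma>2(1) k])
qed

end
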